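(* Let $R_1(z)=\sum_j (z-\lambda_j)_+$ be the first Riesz-mean of the eigenvalues $\lambda_j$ (counted with multiplicity) of the Laplacian on $\mathbb{S}^2$. For $z\ge 0$ let $w\ge 0$ be defined by $w(w+1)=z$. Then for all $z\geq 0$ $$ \frac{1}{2}z^2+2\left(\frac{1}{4}-\psi(w)^2\right)\left(z-\frac{\sqrt{z}}{2}\right)\leq R_1(z)\leq \frac{1}{2}z^2+2\left(\frac{1}{4}-\psi(w)^2\right)\left(z+\frac{\sqrt{z}}{2}+\frac{1}{2}\right). $$ Consequently, for any $\epsilon>0$, $$ \lim_{z\to+\infty} z^{-\epsilon-1/2}\left(R_1(z)-\frac{1}{2}z^2-2\left(\frac14-\psi(w)^2\right)z\right)=0 . $$
   Context: $\mathbb{S}^2$ is the round unit sphere in $\mathbb{R}^3$ and $-\Delta$ its (positive) Laplace-Beltrami operator. Its distinct eigenvalues (energy levels) are $\lambda_{(l)}=l(l+1)$, $l\in\mathbb{N}=\{0,1,2,\dots\}$, with multiplicity $2l+1$; thus $R_1(z)=\sum_{l\ge 0}(2l+1)(z-l(l+1))_+$, where $a_+=\max(a,0)$. The fluctuation function is $\psi(\eta)=\eta-\lfloor\eta\rfloor-\frac12$ for $\eta\ge 0$. *)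

theory Defs
  imports "HOL-Analysis.Analysis" "HOL-Library.Function_Algebras"
begin

definition partial :: "3 \<Rightarrow> (real^3 \<Rightarrow> real) \<Rightarrow> real^3 \<Rightarrow> real" where
  "partial i f x = frechet_derivative f (at x) (axis i 1)"

text \<open>\<open>Ck_on k U f\<close> is meant for open \<open>U\<close>: all iterated partial derivatives of order at most
  \<open>k\<close> exist on \<open>U\<close> and are continuous there.\<close>

primrec Ck_on :: "nat \<Rightarrow> (real^3) set \<Rightarrow> (real^3 \<Rightarrow> real) \<Rightarrow> bool" where
  "Ck_on 0 U f \<longleftrightarrow> continuous_on U f"
| "Ck_on (Suc k) U f \<longleftrightarrow> f differentiable_on U \<and> (\<forall>i. Ck_on k U (partial i f))"

definition smooth_on :: "(real^3) set \<Rightarrow> (real^3 \<Rightarrow> real) \<Rightarrow> bool" where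
  "smooth_on U f \<longleftrightarrow> (\<forall>k. Ck_on k U f)"

definition euclidean_laplacian :: "(real^3 \<Rightarrow> real) \<Rightarrow> real^3 \<Rightarrow> real" where
  "euclidean_laplacian f x = (\<Sum>i\<in>UNIV. partial i (partial i f) x)"

abbreviation S2 :: "(real^3) set" where
  "S2 \<equiv> sphere 0 1"

text \<open>The extension of a function on \<open>S2\<close> that is constant along rays. Since \<open>x \<mapsto> x / |x|\<close> is a
  smooth retraction of the punctured space onto \<open>S2\<close>, a function on the sphere is smooth as a
  function on the manifold iff its radial extension is smooth away from the origin. The radial
  extension has no radial derivatives, so on \<open>S2\<close> its Euclidean Laplacian is the
  Laplace-Beltrami operator of the round metric.\<close>

definition radial_ext :: "(real^3 \<Rightarrow> real) \<Rightarrow> real^3 \<Rightarrow> real" where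
  "radial_ext f x = f (x /\<^sub>R norm x)"

definition smooth_on_S2 :: "(real^3 \<Rightarrow> real) \<Rightarrow> bool" where
  "smooth_on_S2 f \<longleftrightarrow> smooth_on (- {0}) (radial_ext f)"

definition laplace_beltrami :: "(real^3 \<Rightarrow> real) \<Rightarrow> real^3 \<Rightarrow> real" where
  "laplace_beltrami f x = euclidean_laplacian (radial_ext f) x"

text \<open>Functions on \<open>S2\<close> are represented by functions vanishing off \<open>S2\<close>, so that distinct
  elements of an eigenspace are distinct functions on the sphere.\<close>

definition eigenspace :: "real \<Rightarrow> (real^3 \<Rightarrow> real) set" where
  "eigenspace \<mu> = {f. (\<forall>x. x \<notin> S2 \<longrightarrow> f x = 0) \<and> smooth_on_S2 f \<and>
                      (\<forall>x\<in>S2. - laplace_beltrami f x = \<mu> * f x)}"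

definition eigenvalues :: "real set" where
  "eigenvalues = {\<mu>. \<exists>f\<in>eigenspace \<mu>. \<exists>x\<in>S2. f x \<noteq> 0}"

lemma vector_space_real_fun: "vector_space (\<lambda>(c::real) (f::'a \<Rightarrow> real) x. c * f x)"
  by unfold_locales (auto simp: fun_eq_iff algebra_simps)

text \<open>The library's \<open>dim\<close> is \<open>0\<close> on infinite-dimensional spaces, and \<open>infsum\<close> is \<open>0\<close> on
  families that are not summable. The eigenspaces are finite-dimensional and only finitely many
  eigenvalues lie below \<open>z\<close>, so neither convention comes into play.\<close>

definition multiplicity_of_eigenvalue :: "real \<Rightarrow> nat" where
  "multiplicity_of_eigenvalue \<mu> =
     vector_space.dim (\<lambda>(c::real) (f::real^3 \<Rightarrow> real) x. c * f x) (eigenspace \<mu>)"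

definition R\<^sub>1 :: "real \<Rightarrow> real" where
  "R\<^sub>1 z = (\<Sum>\<^sub>\<infinity>\<mu>\<in>eigenvalues. real (multiplicity_of_eigenvalue \<mu>) * max (z - \<mu>) 0)"

definition \<psi> :: "real \<Rightarrow> real" where
  "\<psi> \<eta> = \<eta> - of_int \<lfloor>\<eta>\<rfloor> - 1 / 2"

end

theory Submission
  imports Defs "HOL-Computational_Algebra.Polynomial"
begin

text \<open>
  The statement splits into the determination of the spectrum of the sphere and an exact evaluation
  of a finite sum.

  For the spectrum, everything rests on one computation: for a monomial \<open>x\<^sup>\<alpha>\<close> of degree \<open>n\<close>, the
  Laplacian on the sphere gives \<open>- n (n + 1) x\<^sup>\<alpha>\<close> plus monomials of degree \<open>n - 2\<close>
  (\<open>laplacian_ray_monomial\<close>). Together with the symmetry of the Laplacian, which is obtained by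
  integrating by parts in a spherical shell (\<open>Green_identity_cutoff\<close>), this gives a recursion for the
  moments \<open>\<integral> f x\<^sup>\<alpha>\<close> of an eigenfunction \<open>f\<close> with eigenvalue \<open>\<mu>\<close>: the moments of degree \<open>n\<close> are
  determined by those of degree \<open>n - 2\<close>, unless \<open>n (n + 1) = \<mu>\<close>. A function all of whose moments vanish
  is zero, by the Stone-Weierstrass theorem. So there is no eigenvalue other than the numbers
  \<open>l (l + 1)\<close>, and for \<open>\<mu> = l (l + 1)\<close> an eigenfunction is determined by its moments of degree \<open>l\<close>.
  Since \<open>x\<^sub>3\<^sup>2 = 1 - x\<^sub>1\<^sup>2 - x\<^sub>2\<^sup>2\<close> on the sphere, the \<open>2 l + 1\<close> moments with last exponent at most 1 are
  enough (\<open>eigenfunction_determined_by_critical_moments\<close>), which bounds the multiplicity from above.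

  Conversely, the same triangular form lets each of the \<open>2 l + 1\<close> monomials of degree \<open>l\<close> with last
  exponent at most 1 be corrected by monomials of lower degree to an eigenfunction. These are
  independent: in a vanishing combination the leading part, of degree at most 1 in \<open>x\<^sub>3\<close>, would be
  divisible by \<open>r\<^sup>2\<close> (\<open>spherical_harmonics_scalars_zero\<close>). Hence the multiplicity is \<open>2 l + 1\<close>.

  The Riesz mean is then a finite sum over the levels up to \<open>L = \<lfloor>w\<rfloor>\<close>. With \<open>t = w - L\<close> one finds exactly
  \<open>R\<^sub>1(z) = z\<^sup>2 / 2 + 2 t (1 - t) (z + E / 2)\<close> where \<open>E = (L + 1) (1 - 2 t) + 3/2 t (1 - t)\<close>
  (\<open>Riesz_mean_remainder\<close>), and \<open>1/4 - \<psi>(w)\<^sup>2 = t (1 - t)\<close>. Since \<open>E\<close> lies between \<open>- \<surd>z\<close> and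
  \<open>\<surd>z + 1\<close>, the two bounds follow, and with them the limit.
\<close>

section \<open>Partial derivatives\<close>

lemma partial_eq_has_derivative:
  assumes "(f has_derivative f') (at x)"
  shows "partial i f x = f' (axis i 1)"
  unfolding partial_def using frechet_derivative_at[OF assms] by simp

text \<open>Partial derivatives are values of the Frechet derivative. Once differentiability is known they
can be computed on coordinate lines, where the one-variable calculus applies.\<close>

lemma partial_line_derivative:
  assumes "f differentiable at (x + t *\<^sub>R axis i 1)"
  shows "((\<lambda>s. f (x + s *\<^sub>R axis i 1)) has_real_derivative partial i f (x + t *\<^sub>R axis i 1)) (at t)"
proof -
  let ?f' = "frechet_derivative f (at (x + t *\<^sub>R axis i 1))"
  have f': "(f has_derivative ?f') (at (x + t *\<^sub>R axis i 1))"
    using assms frechet_derivative_works by blast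
  have line: "((\<lambda>s. x + s *\<^sub>R axis i 1) has_derivative (\<lambda>s. s *\<^sub>R axis i 1)) (at t)"
    by (auto intro!: derivative_eq_intros)
  have "((\<lambda>s. f (x + s *\<^sub>R axis i 1)) has_derivative (\<lambda>s. ?f' (s *\<^sub>R axis i 1))) (at t)"
    using has_derivative_compose[OF line f'] by simp
  moreover have "?f' (s *\<^sub>R axis i 1) = partial i f (x + t *\<^sub>R axis i 1) * s" for s
    using linear_scale[OF has_derivative_linear[OF f'], of s "axis i 1"]
    by (simp add: partial_def)
  ultimately show ?thesis
    by (simp add: has_field_derivative_def)
qed

lemma partial_eqI:
  assumes "f differentiable at x"
    and "((\<lambda>s. f (x + s *\<^sub>R axis i 1)) has_real_derivative d) (at 0)"
  shows "partial i f x = d"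
  using DERIV_unique[OF _ assms(2)] partial_line_derivative[of f x 0 i] assms(1) by simp

lemma partial_cong:
  assumes "open U" "x \<in> U" "\<And>y. y \<in> U \<Longrightarrow> f y = g y"
  shows "partial i f x = partial i g x"
proof -
  have "(f has_derivative f') (at x) \<longleftrightarrow> (g has_derivative f') (at x)" for f'
    using has_derivative_transform_within_open[of f f' x UNIV U g]
          has_derivative_transform_within_open[of g f' x UNIV U f] assms by auto
  then show ?thesis
    by (simp add: partial_def frechet_derivative_def)
qed

text \<open>Only the values on the open set matter, although \<open>partial\<close> is a total function. Radial
extensions are only controlled away from the origin, so smoothness has to be
transferred between functions that agree there.\<close>

lemma Ck_on_cong:
  assumes "open U" "\<And>y. y \<in> U \<Longrightarrow> f y = g y"
  shows "Ck_on k U f \<longleftrightarrow> Ck_on k U g"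
  using assms(2)
proof (induction k arbitrary: f g)
  case 0
  then show ?case by (simp cong: continuous_on_cong)
next
  case (Suc k)
  have "f differentiable_on U \<longleftrightarrow> g differentiable_on U"
    unfolding differentiable_on_def differentiable_def
    using Suc.prems by (metis has_derivative_transform)
  moreover have "Ck_on k U (partial i f) \<longleftrightarrow> Ck_on k U (partial i g)" for i
    by (intro Suc.IH partial_cong[OF assms(1) _ Suc.prems])
  ultimately show ?case by simp
qed

text \<open>Sums, multiples and the zero function are all obtained from binary linear combinations, which is
where the factors 1 and 0 in later statements come from.\<close>

lemma partial_linear_combination:
  assumes "f differentiable at x" "g differentiable at x"
  shows "partial i (\<lambda>y. a * f y + b * g y) x = a * partial i f x + b * partial i g x"
proof -
  have "((\<lambda>y. a * f y + b * g y) has_derivative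
      (\<lambda>h. a * frechet_derivative f (at x) h + b * frechet_derivative g (at x) h)) (at x)"
    using assms frechet_derivative_works by (intro has_derivative_add has_derivative_mult_right) auto
  from partial_eq_has_derivative[OF this] show ?thesis by (simp add: partial_def)
qed

lemma Ck_on_linear_combination:
  assumes "open U" "Ck_on k U f" "Ck_on k U g"
  shows "Ck_on k U (\<lambda>y. a * f y + b * g y)"
  using assms(2,3)
proof (induction k arbitrary: f g)
  case 0
  then show ?case by (auto intro!: continuous_intros)
next
  case (Suc k)
  have diff: "f differentiable at y" "g differentiable at y" if "y \<in> U" for y
    using Suc.prems that assms(1) by (simp_all add: differentiable_on_eq_differentiable_at)
  have "(\<lambda>y. a * f y + b * g y) differentiable_on U"
    unfolding differentiable_on_def
    using Suc.prems by (auto simp: differentiable_on_def intro!: derivative_intros)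
  moreover have "Ck_on k U (partial i (\<lambda>y. a * f y + b * g y))" for i
  proof -
    have "Ck_on k U (\<lambda>y. a * partial i f y + b * partial i g y)"
      using Suc by auto
    then show ?thesis
      using Ck_on_cong[OF assms(1), of "partial i (\<lambda>y. a * f y + b * g y)"
          "\<lambda>y. a * partial i f y + b * partial i g y" k]
        partial_linear_combination diff by blast
  qed
  ultimately show ?case by simp
qed

abbreviation punctured :: "(real^3) set" where
  "punctured \<equiv> - {0}"

lemma open_punctured: "open punctured"
  by auto

lemma smooth_on_linear_combination:
  "open U \<Longrightarrow> smooth_on U f \<Longrightarrow> smooth_on U g \<Longrightarrow> smooth_on U (\<lambda>y. a * f y + b * g y)"
  by (simp add: smooth_on_def Ck_on_linear_combination)

lemma smooth_on_cong:
  "open U \<Longrightarrow> (\<And>y. y \<in> U \<Longrightarrow> f y = g y) \<Longrightarrow> smooth_on U f \<longleftrightarrow> smooth_on U g"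
  using Ck_on_cong unfolding smooth_on_def by blast

lemma smooth_on_imp_continuous_on: "smooth_on U f \<Longrightarrow> continuous_on U f"
  unfolding smooth_on_def by (metis Ck_on.simps(1))

lemma smooth_on_imp_differentiable:
  "open U \<Longrightarrow> smooth_on U f \<Longrightarrow> x \<in> U \<Longrightarrow> f differentiable at x"
  unfolding smooth_on_def
  by (metis Ck_on.simps(2) at_within_open differentiable_on_def)

lemma smooth_on_partial: "smooth_on U f \<Longrightarrow> smooth_on U (partial i f)"
  unfolding smooth_on_def by (metis Ck_on.simps(2))

lemma euclidean_laplacian_cong:
  assumes "open U" "x \<in> U" "\<And>y. y \<in> U \<Longrightarrow> f y = g y"
  shows "euclidean_laplacian f x = euclidean_laplacian g x"
  unfolding euclidean_laplacian_def
  using assms by (intro sum.cong refl partial_cong[of U] partial_cong[OF assms(1) _ assms(3)]) auto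

lemma euclidean_laplacian_linear_combination:
  assumes "open U" "smooth_on U f" "smooth_on U g" "x \<in> U"
  shows "euclidean_laplacian (\<lambda>y. a * f y + b * g y) x =
    a * euclidean_laplacian f x + b * euclidean_laplacian g x"
proof -
  have "partial i (partial i (\<lambda>y. a * f y + b * g y)) x =
      a * partial i (partial i f) x + b * partial i (partial i g) x" for i
  proof -
    have "partial i (partial i (\<lambda>y. a * f y + b * g y)) x =
        partial i (\<lambda>y. a * partial i f y + b * partial i g y) x"
      using assms
      by (intro partial_cong[of U] partial_linear_combination)
         (auto intro: smooth_on_imp_differentiable)
    also have "\<dots> = a * partial i (partial i f) x + b * partial i (partial i g) x"
      using assms by (intro partial_linear_combination)
         (auto intro: smooth_on_imp_differentiable smooth_on_partial)
    finally show ?thesis .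
  qed
  then show ?thesis
    by (simp add: euclidean_laplacian_def sum.distrib sum_distrib_left)
qed

section \<open>Monomials and the Laplacian of their radial extensions\<close>

definition monomial :: "(3 \<Rightarrow> nat) \<Rightarrow> real^3 \<Rightarrow> real" where
  "monomial \<alpha> x = (\<Prod>j\<in>UNIV. x $ j ^ \<alpha> j)"

definition deg :: "(3 \<Rightarrow> nat) \<Rightarrow> nat" where
  "deg \<alpha> = (\<Sum>j\<in>UNIV. \<alpha> j)"

text \<open>The power of the norm is independent of the degree, so that the linear span of the family is
  closed under partial differentiation.\<close>

definition scaled_monomial :: "(3 \<Rightarrow> nat) \<Rightarrow> nat \<Rightarrow> real^3 \<Rightarrow> real" where
  "scaled_monomial \<alpha> k x = monomial \<alpha> x * inverse (norm x) ^ k"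

text \<open>With the power of the norm equal to the degree the function is constant along rays: away
  from the origin it is the radial extension of the monomial.\<close>

abbreviation ray_monomial :: "(3 \<Rightarrow> nat) \<Rightarrow> real^3 \<Rightarrow> real" where
  "ray_monomial \<alpha> \<equiv> scaled_monomial \<alpha> (deg \<alpha>)"

abbreviation raise :: "nat \<Rightarrow> 3 \<Rightarrow> (3 \<Rightarrow> nat) \<Rightarrow> (3 \<Rightarrow> nat)" where
  "raise k i \<alpha> \<equiv> \<alpha>(i := \<alpha> i + k)"

abbreviation lower :: "nat \<Rightarrow> 3 \<Rightarrow> (3 \<Rightarrow> nat) \<Rightarrow> (3 \<Rightarrow> nat)" where
  "lower k i \<alpha> \<equiv> \<alpha>(i := \<alpha> i - k)"

lemma monomial_split: "monomial \<alpha> x = x $ i ^ \<alpha> i * (\<Prod>j\<in>UNIV-{i}. x $ j ^ \<alpha> j)"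
  unfolding monomial_def by (simp add: prod.remove)

lemma monomial_upd: "monomial (\<alpha>(i := n)) x = x $ i ^ n * (\<Prod>j\<in>UNIV-{i}. x $ j ^ \<alpha> j)"
  unfolding monomial_split[of "\<alpha>(i := n)" x i] by (auto intro!: prod.cong)

lemma monomial_raise: "monomial (raise k i \<alpha>) x = x $ i ^ k * monomial \<alpha> x"
  by (simp add: monomial_upd monomial_split[of \<alpha> x i] power_add mult_ac)

lemma deg_upd: "deg (\<alpha>(i := n)) + \<alpha> i = deg \<alpha> + n"
proof -
  have "deg \<beta> = \<beta> i + (\<Sum>j\<in>UNIV-{i}. \<beta> j)" for \<beta>
    unfolding deg_def by (simp add: sum.remove)
  from this[of "\<alpha>(i := n)"] this[of \<alpha>] show ?thesis by simp
qed

lemma deg_raise [simp]: "deg (raise k i \<alpha>) = deg \<alpha> + k"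
  using deg_upd[of \<alpha> i "\<alpha> i + k"] by simp

lemma deg_lower: "k \<le> \<alpha> i \<Longrightarrow> deg (lower k i \<alpha>) + k = deg \<alpha>"
  using deg_upd[of \<alpha> i "\<alpha> i - k"] by simp

lemma has_derivative_inverse_norm:
  fixes x :: "'a::real_inner"
  assumes "x \<noteq> 0"
  shows "((\<lambda>y. inverse (norm y)) has_derivative (\<lambda>h. - (x \<bullet> h) * inverse (norm x) ^ 3)) (at x)"
proof -
  have "((\<lambda>y. inverse (norm y)) has_derivative
      (\<lambda>h. - (inverse (norm x) * (h \<bullet> sgn x) * inverse (norm x)))) (at x)"
    using assms by (intro Deriv.has_derivative_inverse has_derivative_norm) auto
  also have "(\<lambda>h. - (inverse (norm x) * (h \<bullet> sgn x) * inverse (norm x))) =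
      (\<lambda>h. - (x \<bullet> h) * inverse (norm x) ^ 3)"
    by (auto simp: fun_eq_iff sgn_div_norm power3_eq_cube inner_commute)
  finally show ?thesis .
qed

lemma monomial_differentiable: "monomial \<alpha> differentiable at x"
proof -
  have "((\<lambda>x::real^3. x $ j ^ n) has_derivative (\<lambda>h. real n * x $ j ^ (n - 1) * h $ j)) (at x)" for j n
    by (auto intro!: derivative_eq_intros bounded_linear_vec_nth[THEN bounded_linear_imp_has_derivative]
        simp: mult_ac)
  then have "((\<lambda>x. \<Prod>j\<in>UNIV. x $ j ^ \<alpha> j) has_derivative
     (\<lambda>y. \<Sum>i\<in>UNIV. (real (\<alpha> i) * x $ i ^ (\<alpha> i - 1) * y $ i) * (\<Prod>j\<in>UNIV - {i}. x $ j ^ \<alpha> j))) (at x)"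
    by (intro has_derivative_prod) auto
  then show ?thesis
    unfolding monomial_def[abs_def] differentiable_def by blast
qed

lemma scaled_monomial_differentiable:
  "x \<noteq> 0 \<Longrightarrow> scaled_monomial \<alpha> k differentiable at x"
  unfolding scaled_monomial_def[abs_def]
  by (auto intro!: derivative_intros monomial_differentiable)

text \<open>The first summand differentiates the monomial, the second the power of the norm, whose derivative
is \<open>\<partial>\<^sub>i r\<^sup>-\<^sup>k = - k x\<^sub>i r\<^sup>-\<^sup>k\<^sup>-\<^sup>2\<close>. If \<open>\<alpha> i = 0\<close> the truncated exponent
\<open>\<alpha> i - 1\<close> is harmless because its coefficient vanishes.\<close>

lemma partial_scaled_monomial:
  assumes "x \<noteq> 0"
  shows "partial i (scaled_monomial \<alpha> k) x =
    real (\<alpha> i) * scaled_monomial (lower 1 i \<alpha>) k x +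
    (- real k) * scaled_monomial (raise 1 i \<alpha>) (k + 2) x"
proof (rule partial_eqI)
  show "scaled_monomial \<alpha> k differentiable at x"
    using assms by (rule scaled_monomial_differentiable)
  let ?P = "\<Prod>j\<in>UNIV-{i}. x $ j ^ \<alpha> j" and ?\<rho> = "inverse (norm x)"
  have line: "scaled_monomial \<alpha> k (x + s *\<^sub>R axis i 1) =
      (x $ i + s) ^ \<alpha> i * ?P * inverse (norm (x + s *\<^sub>R axis i 1)) ^ k" for s
    unfolding scaled_monomial_def monomial_split[of \<alpha> _ i] by (simp add: axis_def)
  have "((\<lambda>y. inverse (norm y)) has_derivative (\<lambda>h. - (x \<bullet> h) * ?\<rho> ^ 3)) (at x)"
    using assms by (rule has_derivative_inverse_norm)
  then have "(\<lambda>y. inverse (norm y)) differentiable at (x + 0 *\<^sub>R axis i 1)"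
    "partial i (\<lambda>y. inverse (norm y)) (x + 0 *\<^sub>R axis i 1) = - (x $ i) * ?\<rho> ^ 3"
    using partial_eq_has_derivative[of "\<lambda>y. inverse (norm y)" _ x i]
    by (auto simp: differentiable_def inner_axis)
  from partial_line_derivative[OF this(1)] this(2)
  have \<rho>: "((\<lambda>s. inverse (norm (x + s *\<^sub>R axis i 1))) has_real_derivative - (x $ i) * ?\<rho> ^ 3) (at 0)"
    by simp
  have \<rho>k: "((\<lambda>s. inverse (norm (x + s *\<^sub>R axis i 1)) ^ k) has_real_derivative
      - real k * x $ i * ?\<rho> ^ (k + 2)) (at 0)"
  proof -
    have "real k * (?\<rho> ^ (k - Suc 0) * (- (x $ i) * ?\<rho> ^ 3)) = - real k * x $ i * ?\<rho> ^ (k + 2)"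
      by (cases k) (auto simp: power_add power3_eq_cube power2_eq_square algebra_simps)
    with DERIV_power[OF \<rho>, of k] show ?thesis
      by (elim DERIV_cong) (simp add: mult_ac)
  qed
  have xi: "((\<lambda>s. (x $ i + s) ^ \<alpha> i * ?P) has_real_derivative
      real (\<alpha> i) * x $ i ^ (\<alpha> i - 1) * ?P) (at 0)"
    by (auto intro!: derivative_eq_intros)
  show "((\<lambda>s. scaled_monomial \<alpha> k (x + s *\<^sub>R axis i 1)) has_real_derivative
      real (\<alpha> i) * scaled_monomial (lower 1 i \<alpha>) k x +
      (- real k) * scaled_monomial (raise 1 i \<alpha>) (k + 2) x) (at 0)"
    unfolding line using DERIV_mult[OF xi \<rho>k]
    by (simp add: scaled_monomial_def monomial_upd algebra_simps)
qed

lemma smooth_scaled_monomial: "smooth_on punctured (scaled_monomial \<alpha> k)"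
proof -
  have "Ck_on n punctured (scaled_monomial \<alpha> k)" for n
  proof (induction n arbitrary: \<alpha> k)
    case 0
    have "scaled_monomial \<alpha> k differentiable_on punctured"
      by (auto simp: differentiable_on_def
          intro: differentiable_at_withinI scaled_monomial_differentiable)
    then show ?case using differentiable_imp_continuous_on by auto
  next
    case (Suc n)
    have "Ck_on n punctured (partial i (scaled_monomial \<alpha> k))" for i
    proof (rule Ck_on_cong[OF open_punctured, THEN iffD2])
      show "Ck_on n punctured (\<lambda>y. real (\<alpha> i) * scaled_monomial (lower 1 i \<alpha>) k y +
          (- real k) * scaled_monomial (raise 1 i \<alpha>) (k + 2) y)"
        by (intro Ck_on_linear_combination open_punctured Suc)
    qed (rule partial_scaled_monomial, simp)
    then show ?case
      by (auto simp: differentiable_on_def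
          intro: differentiable_at_withinI scaled_monomial_differentiable)
  qed
  then show ?thesis by (simp add: smooth_on_def)
qed

lemma partial_partial_scaled_monomial:
  assumes "x \<noteq> 0"
  shows "partial i (partial i (scaled_monomial \<alpha> k)) x =
    real (\<alpha> i * (\<alpha> i - 1)) * scaled_monomial (lower 2 i \<alpha>) k x
    - real k * (2 * real (\<alpha> i) + 1) * scaled_monomial \<alpha> (k + 2) x
    + real k * (real k + 2) * ((x $ i)\<^sup>2 * scaled_monomial \<alpha> (k + 4) x)"
proof -
  have "partial i (partial i (scaled_monomial \<alpha> k)) x =
      partial i (\<lambda>y. real (\<alpha> i) * scaled_monomial (lower 1 i \<alpha>) k y +
        (- real k) * scaled_monomial (raise 1 i \<alpha>) (k + 2) y) x"
    using assms partial_scaled_monomial by (intro partial_cong[OF open_punctured]) auto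
  also have "\<dots> = real (\<alpha> i) * partial i (scaled_monomial (lower 1 i \<alpha>) k) x +
        (- real k) * partial i (scaled_monomial (raise 1 i \<alpha>) (k + 2)) x"
    using assms by (intro partial_linear_combination scaled_monomial_differentiable)
  also have "\<dots> = real (\<alpha> i * (\<alpha> i - 1)) * scaled_monomial (lower 2 i \<alpha>) k x
    - real k * (real (\<alpha> i) * scaled_monomial \<alpha> (k + 2) x)
    - real k * ((real (\<alpha> i) + 1) * scaled_monomial \<alpha> (k + 2) x
       - (real k + 2) * ((x $ i)\<^sup>2 * scaled_monomial \<alpha> (k + 4) x))"
  proof -
    have raise_lower: "real (\<alpha> i) * scaled_monomial (raise 1 i (lower 1 i \<alpha>)) (k + 2) x =
        real (\<alpha> i) * scaled_monomial \<alpha> (k + 2) x"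
    proof (cases "\<alpha> i")
      case (Suc m)
      then have "raise 1 i (lower 1 i \<alpha>) = \<alpha>" by (auto simp: fun_eq_iff)
      then show ?thesis by (simp only:)
    qed simp
    have "lower 1 i (lower 1 i \<alpha>) = lower 2 i \<alpha>"
      by (simp add: numeral_2_eq_2)
    then have low: "partial i (scaled_monomial (lower 1 i \<alpha>) k) x =
        real (\<alpha> i - 1) * scaled_monomial (lower 2 i \<alpha>) k x
        - real k * scaled_monomial (raise 1 i (lower 1 i \<alpha>)) (k + 2) x"
      using partial_scaled_monomial[OF assms, of i "lower 1 i \<alpha>" k] by simp
    have "scaled_monomial (raise 1 i (raise 1 i \<alpha>)) (k + 2 + 2) x =
        (x $ i)\<^sup>2 * scaled_monomial \<alpha> (k + 4) x"
      unfolding scaled_monomial_def monomial_raise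
      by (simp add: power2_eq_square power_add power4_eq_xxxx)
    moreover have "lower 1 i (raise 1 i \<alpha>) = \<alpha>"
      by simp
    ultimately have up: "partial i (scaled_monomial (raise 1 i \<alpha>) (k + 2)) x =
        (real (\<alpha> i) + 1) * scaled_monomial \<alpha> (k + 2) x
        - (real k + 2) * ((x $ i)\<^sup>2 * scaled_monomial \<alpha> (k + 4) x)"
      using partial_scaled_monomial[OF assms, of i "raise 1 i \<alpha>" "k + 2"]
      by (simp only:) (simp add: algebra_simps)
    have "real (\<alpha> i) * (real (\<alpha> i - 1) * A - real k * B) =
        real (\<alpha> i * (\<alpha> i - 1)) * A - real k * (real (\<alpha> i) * B)" for A B :: real
      by (simp only: of_nat_mult right_diff_distrib mult_ac)
    then show ?thesis
      unfolding low up raise_lower[symmetric] by simp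
  qed
  finally show ?thesis by (simp add: algebra_simps)
qed

lemma sum_squares_norm: "(\<Sum>i\<in>UNIV. (x $ i)\<^sup>2) = (norm x)\<^sup>2" for x :: "real^3"
  by (simp add: norm_vec_def L2_set_def sum_nonneg)

text \<open>Summing the second derivatives over the three coordinates, the terms with \<open>x\<^sup>\<alpha> r\<^sup>-\<^sup>n\<^sup>-\<^sup>2\<close> have
total coefficient \<open>- n (2 n + 3) + n (n + 2) = - n (n + 1)\<close>. Hence the Laplacian on the sphere is
triangular on monomials: degree \<open>n\<close> is multiplied by \<open>- n (n + 1)\<close>, up to monomials of degree
\<open>n - 2\<close>.\<close>

lemma laplacian_ray_monomial:
  assumes "x \<noteq> 0"
  shows "euclidean_laplacian (ray_monomial \<alpha>) x =
    inverse (norm x) ^ 2 * ((\<Sum>i\<in>UNIV. real (\<alpha> i * (\<alpha> i - 1)) * ray_monomial (lower 2 i \<alpha>) x)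
      - real (deg \<alpha>) * (real (deg \<alpha>) + 1) * ray_monomial \<alpha> x)"
proof -
  let ?n = "deg \<alpha>" and ?\<rho> = "inverse (norm x)"
  have sq: "?\<rho> ^ 2 * (norm x)\<^sup>2 = 1"
    using assms by (simp add: field_simps)
  have low: "real (\<alpha> i * (\<alpha> i - 1)) * scaled_monomial (lower 2 i \<alpha>) ?n x =
     ?\<rho> ^ 2 * (real (\<alpha> i * (\<alpha> i - 1)) * ray_monomial (lower 2 i \<alpha>) x)" for i
  proof (cases "2 \<le> \<alpha> i")
    case True
    from deg_lower[of 2 \<alpha> i, OF True] have "?n = deg (lower 2 i \<alpha>) + 2" by simp
    then have "scaled_monomial (lower 2 i \<alpha>) ?n x = ?\<rho> ^ 2 * ray_monomial (lower 2 i \<alpha>) x"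
      by (simp only: scaled_monomial_def power_add) simp
    then show ?thesis by simp
  next
    case False
    then have "\<alpha> i = 0 \<or> \<alpha> i = 1" by auto
    then show ?thesis by auto
  qed
  have "euclidean_laplacian (ray_monomial \<alpha>) x =
     (\<Sum>i\<in>UNIV. ?\<rho> ^ 2 * (real (\<alpha> i * (\<alpha> i - 1)) * ray_monomial (lower 2 i \<alpha>) x))
     - (\<Sum>i\<in>UNIV. real ?n * (2 * real (\<alpha> i) + 1) * scaled_monomial \<alpha> (?n + 2) x)
     + (\<Sum>i\<in>UNIV. (x $ i)\<^sup>2) * (real ?n * (real ?n + 2) * scaled_monomial \<alpha> (?n + 4) x)"
    unfolding euclidean_laplacian_def partial_partial_scaled_monomial[OF assms] low
    by (simp add: sum.distrib sum_subtractf sum_distrib_right sum_distrib_left mult_ac)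
  moreover have "(\<Sum>i\<in>UNIV. real ?n * (2 * real (\<alpha> i) + 1) * scaled_monomial \<alpha> (?n + 2) x) =
     real ?n * (2 * real ?n + 3) * (?\<rho> ^ 2 * ray_monomial \<alpha> x)"
    by (simp add: deg_def sum_3 scaled_monomial_def power_add algebra_simps power2_eq_square)
  moreover have "(\<Sum>i\<in>UNIV. (x $ i)\<^sup>2) * (real ?n * (real ?n + 2) * scaled_monomial \<alpha> (?n + 4) x)
     = real ?n * (real ?n + 2) * (?\<rho> ^ 2 * ray_monomial \<alpha> x)"
  proof -
    have "(norm x)\<^sup>2 * ?\<rho> ^ (?n + 4) = ?\<rho> ^ 2 * ?\<rho> ^ ?n * (?\<rho> ^ 2 * (norm x)\<^sup>2)"
      by (simp add: power_add power4_eq_xxxx power2_eq_square)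
    then have "(norm x)\<^sup>2 * scaled_monomial \<alpha> (?n + 4) x = ?\<rho> ^ 2 * ray_monomial \<alpha> x"
      unfolding sq scaled_monomial_def by (simp add: algebra_simps)
    then show ?thesis unfolding sum_squares_norm by (simp add: algebra_simps)
  qed
  ultimately show ?thesis
    by (simp add: sum_distrib_left algebra_simps)
qed

section \<open>Integration by parts\<close>

lemma integrable_lborel_compact_support:
  fixes h :: "'a::euclidean_space \<Rightarrow> real"
  assumes "continuous_on UNIV h" "\<And>x. norm x > r \<Longrightarrow> h x = 0"
  shows "integrable lborel h"
proof -
  have "integrable lborel (\<lambda>x. indicator (cball 0 r) x *\<^sub>R h x)"
    using assms(1) by (intro borel_integrable_compact) (auto intro: continuous_on_subset)
  moreover have "(\<lambda>x. indicator (cball 0 r) x *\<^sub>R h x) = h"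
    using assms(2) by (force simp: indicator_def)
  ultimately show ?thesis by simp
qed

lemma integral_translation_lborel:
  fixes h :: "'a::euclidean_space \<Rightarrow> real"
  assumes "h \<in> borel_measurable borel"
  shows "(\<integral>x. h (x + c) \<partial>lborel) = (\<integral>x. h x \<partial>lborel)"
proof -
  have "(\<integral>x. h x \<partial>lborel) = (\<integral>x. h x \<partial>(distr lborel borel ((+) c)))"
    by (simp add: lborel_distr_plus)
  also have "\<dots> = (\<integral>x. h (c + x) \<partial>lborel)"
    using assms by (intro integral_distr) auto
  finally show ?thesis by (simp add: add.commute)
qed

text \<open>The integral of the difference quotient of \<open>G\<close> in direction \<open>e\<close> vanishes, because Lebesgue measure
is translation invariant. The quotients are dominated by the supremum of \<open>D\<close> on a ball, by the
mean value theorem, and converge to \<open>D\<close>.\<close>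

lemma integral_directional_derivative_eq_0:
  fixes G D :: "'a::euclidean_space \<Rightarrow> real"
  assumes G: "continuous_on UNIV G" and D: "continuous_on UNIV D"
    and deriv: "\<And>x. ((\<lambda>t. G (x + t *\<^sub>R e)) has_real_derivative D x) (at 0)"
    and supp: "\<And>x. norm x > r \<Longrightarrow> G x = 0"
  shows "(\<integral>x. D x \<partial>lborel) = 0"
proof -
  define h where "h n = inverse (real (Suc n))" for n
  have h: "0 < h n" "h n \<le> 1" "h n * real (Suc n) = 1" for n
    by (auto simp: h_def field_simps)
  define q where "q n x = (G (x + h n *\<^sub>R e) - G x) / h n" for n x
  have "compact (D ` cball 0 (r + 2 * norm e))"
    using D by (intro compact_continuous_image compact_cball) (auto intro: continuous_on_subset)
  then obtain B where B: "\<And>x. norm x \<le> r + 2 * norm e \<Longrightarrow> \<bar>D x\<bar> \<le> B"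
    by (force dest!: compact_imp_bounded simp: bounded_iff)
  have line: "((\<lambda>t. G (x + t *\<^sub>R e)) has_real_derivative D (x + s *\<^sub>R e)) (at s)" for x s
  proof -
    have "((\<lambda>t. G (x + s *\<^sub>R e + t *\<^sub>R e)) has_real_derivative D (x + s *\<^sub>R e)) (at 0)"
      by (rule deriv)
    then have "((\<lambda>t. G (x + (t + s) *\<^sub>R e)) has_real_derivative D (x + s *\<^sub>R e)) (at 0)"
      by (simp add: algebra_simps)
    then show ?thesis
      using DERIV_shift[of "\<lambda>t. G (x + t *\<^sub>R e)" "D (x + s *\<^sub>R e)" 0 s] by simp
  qed
  have bound: "norm (q n x) \<le> max 0 B * indicator (cball 0 (r + norm e)) x" for n x
  proof (cases "norm x \<le> r + norm e")
    case True
    obtain z where z: "0 < z" "z < h n" "G (x + h n *\<^sub>R e) - G (x + 0 *\<^sub>R e) = (h n - 0) * D (x + z *\<^sub>R e)"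
      using MVT2[OF h(1)[of n], of "\<lambda>t. G (x + t *\<^sub>R e)" "\<lambda>s. D (x + s *\<^sub>R e)"] line by blast
    have "norm (x + z *\<^sub>R e) \<le> norm x + z * norm e"
      using norm_triangle_ineq[of x "z *\<^sub>R e"] z by simp
    also have "z * norm e \<le> 1 * norm e"
      using z h(2)[of n] by (intro mult_right_mono) auto
    finally have "\<bar>D (x + z *\<^sub>R e)\<bar> \<le> B"
      using True by (intro B) auto
    moreover have "q n x = D (x + z *\<^sub>R e)"
      using z h(1)[of n] by (simp add: q_def)
    ultimately show ?thesis using True by (simp add: indicator_def)
  next
    case False
    have "h n * norm e \<le> 1 * norm e"
      using h[of n] by (intro mult_right_mono) auto
    moreover have "norm x \<le> norm (x + h n *\<^sub>R e) + norm (h n *\<^sub>R e)"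
      using norm_triangle_ineq4[of "x + h n *\<^sub>R e" "h n *\<^sub>R e"] by simp
    ultimately have "norm (x + h n *\<^sub>R e) > r"
      using False h(1)[of n] by simp
    moreover have "norm x > r"
      using False norm_ge_zero[of e] by linarith
    ultimately show ?thesis using supp by (simp add: q_def)
  qed
  have lim: "(\<lambda>n. q n x) \<longlonglongrightarrow> D x" for x
  proof -
    have "((\<lambda>t. (G (x + t *\<^sub>R e) - G x) / t) \<longlongrightarrow> D x) (at 0)"
      using deriv[of x] by (simp add: DERIV_def)
    moreover have "filterlim h (at 0) sequentially"
      unfolding filterlim_at using h(1) LIMSEQ_inverse_real_of_nat
      by (auto simp: h_def[abs_def] less_imp_neq[symmetric] simp del: of_nat_Suc)
    ultimately show ?thesis
      unfolding q_def by (rule filterlim_compose)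
  qed
  have Gm: "G \<in> borel_measurable borel" and Dm: "D \<in> borel_measurable borel"
    using G D by (auto intro: borel_measurable_continuous_onI)
  have Gi: "integrable lborel G"
    using G supp by (rule integrable_lborel_compact_support)
  have q0: "(\<integral>x. q n x \<partial>lborel) = 0" for n
  proof -
    have "integrable lborel (\<lambda>x. G (x + h n *\<^sub>R e))"
    proof (rule integrable_lborel_compact_support[where r = "r + norm e"])
      show "continuous_on UNIV (\<lambda>x. G (x + h n *\<^sub>R e))"
        by (intro continuous_on_compose2[OF G] continuous_intros) auto
      show "G (x + h n *\<^sub>R e) = 0" if "norm x > r + norm e" for x
      proof -
        have "h n * norm e \<le> 1 * norm e"
          using h[of n] by (intro mult_right_mono) auto
        moreover have "norm x \<le> norm (x + h n *\<^sub>R e) + norm (h n *\<^sub>R e)"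
          using norm_triangle_ineq4[of "x + h n *\<^sub>R e" "h n *\<^sub>R e"] by simp
        ultimately show ?thesis
          using that h(1)[of n] by (intro supp) simp
      qed
    qed
    then have "(\<integral>x. q n x \<partial>lborel) = ((\<integral>x. G (x + h n *\<^sub>R e) \<partial>lborel) - (\<integral>x. G x \<partial>lborel)) / h n"
      unfolding q_def using Gi by simp
    then show ?thesis using integral_translation_lborel[OF Gm] by simp
  qed
  have "(\<lambda>n. \<integral>x. q n x \<partial>lborel) \<longlonglongrightarrow> (\<integral>x. D x \<partial>lborel)"
  proof (rule integral_dominated_convergence[where w = "\<lambda>x. max 0 B * indicator (cball 0 (r + norm e)) x"])
    show "integrable lborel (\<lambda>x::'a. max 0 B * indicator (cball 0 (r + norm e)) x :: real)"
      using emeasure_compact_finite[OF compact_cball, of "0 :: 'a" "r + norm e"]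
      by (intro integrable_mult_right integrable_real_indicator) auto
    show "(\<lambda>x. q n x) \<in> borel_measurable lborel" for n
      unfolding q_def using Gm by measurable
  qed (use Dm lim bound in auto)
  then show ?thesis
    unfolding q0 by (simp add: LIMSEQ_const_iff)
qed

text \<open>Positive exactly on the spherical shell between the radii 1 and 2.\<close>

definition shell :: "real^3 \<Rightarrow> real" where
  "shell x = (x \<bullet> x - 1) * (4 - x \<bullet> x)"

text \<open>Squaring the positive part makes the cutoff continuously differentiable. It is radial, and it
  keeps all integrals away from the origin, where radial extensions are singular.\<close>

definition cutoff :: "real^3 \<Rightarrow> real" where
  "cutoff x = (max 0 (shell x))\<^sup>2"

text \<open>The gradient of the cutoff at \<open>x\<close> is this factor times \<open>x\<close>.\<close>

definition cutoff_slope :: "real^3 \<Rightarrow> real" where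
  "cutoff_slope x = 2 * max 0 (shell x) * (10 - 4 * (x \<bullet> x))"

lemma max_shell_eq_0:
  assumes "norm x \<le> 1 \<or> 2 \<le> norm x"
  shows "max 0 (shell x) = 0"
proof -
  have "x \<bullet> x \<le> 1 \<or> 4 \<le> x \<bullet> x"
  proof (cases "norm x \<le> 1")
    case True
    then have "(norm x)\<^sup>2 \<le> 1" by (simp add: power_le_one)
    then show ?thesis by (simp add: dot_square_norm)
  next
    case False
    then have "2\<^sup>2 \<le> (norm x)\<^sup>2" using assms by (intro power_mono) auto
    then show ?thesis by (simp add: dot_square_norm)
  qed
  then have "shell x \<le> 0"
    unfolding shell_def by (auto simp: mult_le_0_iff inner_ge_zero)
  then show ?thesis by simp
qed

lemma cutoff_eq_0: "norm x \<le> 1 \<or> 2 \<le> norm x \<Longrightarrow> cutoff x = 0"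
  unfolding cutoff_def by (simp add: max_shell_eq_0)

lemma cutoff_slope_eq_0: "norm x \<le> 1 \<or> 2 \<le> norm x \<Longrightarrow> cutoff_slope x = 0"
  unfolding cutoff_slope_def by (simp add: max_shell_eq_0)

lemma cutoff_nonneg: "0 \<le> cutoff x"
  by (simp add: cutoff_def)

lemma continuous_on_cutoff: "continuous_on UNIV cutoff" "continuous_on UNIV cutoff_slope"
  unfolding cutoff_def[abs_def] cutoff_slope_def[abs_def] shell_def[abs_def]
  by (intro continuous_intros)+

lemma continuous_on_cutoff_mult:
  fixes c :: "'a::real_normed_vector \<Rightarrow> real"
  assumes "continuous_on UNIV c" "\<And>x. norm x < 1 \<Longrightarrow> c x = 0" "continuous_on (- {0}) g"
  shows "continuous_on UNIV (\<lambda>x. c x * g x)"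
proof -
  have "continuous_on (- {0}) (\<lambda>x. c x * g x)"
    using assms by (intro continuous_intros) (auto intro: continuous_on_subset)
  moreover have "continuous_on (ball 0 1) (\<lambda>x. c x * g x)"
    using assms(2) by (subst continuous_on_cong[where g = "\<lambda>_. 0", OF refl]) auto
  ultimately have "continuous_on (- {0} \<union> ball 0 1) (\<lambda>x. c x * g x)"
    by (intro continuous_on_open_Un) auto
  moreover have "- {0} \<union> ball 0 1 = (UNIV :: 'a set)"
    by auto
  ultimately show ?thesis by simp
qed

lemma integrable_cutoff_mult:
  assumes "continuous_on punctured g"
  shows "integrable lborel (\<lambda>x. cutoff x * g x)"
  by (rule integrable_lborel_compact_support[where r = 2])
     (auto intro!: continuous_on_cutoff_mult continuous_on_cutoff assms simp: cutoff_eq_0)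

lemma DERIV_max_0_square: "((\<lambda>t. (max 0 t)\<^sup>2) has_real_derivative 2 * max 0 t) (at t)"
proof -
  consider "t > 0" | "t < 0" | "t = 0" by linarith
  then show ?thesis
  proof cases
    case 1
    have "((\<lambda>t::real. t\<^sup>2) has_real_derivative 2 * t) (at t)"
      by (auto intro!: derivative_eq_intros)
    then show ?thesis
      using 1 by (auto intro: has_field_derivative_transform_within_open[of _ _ _ "{0<..}"])
  next
    case 2
    have "((\<lambda>t::real. 0) has_real_derivative 0) (at t)"
      by simp
    then show ?thesis
      using has_field_derivative_transform_within_open[of "\<lambda>_. 0" 0 t "{..<0}" "\<lambda>t. (max 0 t)\<^sup>2"] 2
      by auto
  next
    case 3
    have "((\<lambda>h::real. ((max 0 (0 + h))\<^sup>2 - (max 0 0)\<^sup>2) / h) \<longlongrightarrow> 0) (at 0)"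
    proof (rule Lim_null_comparison)
      have "norm (((max 0 (0 + h))\<^sup>2 - (max 0 0)\<^sup>2) / h) \<le> \<bar>h\<bar>" for h :: real
        by (cases "h > 0") (auto simp: power2_eq_square)
      then show "\<forall>\<^sub>F h::real in at 0. norm (((max 0 (0 + h))\<^sup>2 - (max 0 0)\<^sup>2) / h) \<le> \<bar>h\<bar>"
        by simp
      show "((\<lambda>h::real. \<bar>h\<bar>) \<longlongrightarrow> 0) (at 0)"
        by (rule tendsto_rabs_zero) simp
    qed
    then show ?thesis using 3 by (simp add: DERIV_def)
  qed
qed

lemma cutoff_line_derivative:
  "((\<lambda>t. cutoff (x + t *\<^sub>R axis i 1)) has_real_derivative x $ i * cutoff_slope x) (at 0)"
proof -
  let ?r = "\<lambda>t. (x + t *\<^sub>R axis i 1) \<bullet> (x + t *\<^sub>R axis i 1)"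
  have "?r = (\<lambda>t. x \<bullet> x + 2 * t * x $ i + t\<^sup>2)"
    by (auto simp: inner_add_left inner_add_right inner_axis inner_axis' power2_eq_square algebra_simps)
  then have r: "(?r has_real_derivative 2 * x $ i) (at 0)"
    by (auto intro!: derivative_eq_intros)
  have "((\<lambda>t. (?r t - 1) * (4 - ?r t)) has_real_derivative
      (2 * x $ i) * (4 - ?r 0) + (0 - 2 * x $ i) * (?r 0 - 1)) (at 0)"
    by (rule derivative_eq_intros r refl)+ simp
  then have s: "((\<lambda>t. shell (x + t *\<^sub>R axis i 1)) has_real_derivative
      x $ i * (10 - 4 * (x \<bullet> x))) (at 0)"
    unfolding shell_def by (rule DERIV_cong) (simp add: algebra_simps)
  show ?thesis
    unfolding cutoff_def using DERIV_chain2[OF DERIV_max_0_square s]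
    by (rule DERIV_cong) (simp add: cutoff_slope_def)
qed

text \<open>The integrand differs from the divergence of \<open>cutoff (F \<nabla>R - R \<nabla>F)\<close> by the product of the gradient of
the cutoff with \<open>F \<nabla>R - R \<nabla>F\<close>. That gradient is radial, and \<open>F\<close> and \<open>R\<close> have no radial derivative,
so the difference is zero.\<close>

lemma Green_identity_cutoff:
  assumes F: "smooth_on punctured F" and R: "smooth_on punctured R"
    and F0: "\<And>x. x \<noteq> 0 \<Longrightarrow> (\<Sum>i\<in>UNIV. x $ i * partial i F x) = 0"
    and R0: "\<And>x. x \<noteq> 0 \<Longrightarrow> (\<Sum>i\<in>UNIV. x $ i * partial i R x) = 0"
  shows "(\<integral>x. cutoff x * (F x * euclidean_laplacian R x - R x * euclidean_laplacian F x) \<partial>lborel) = 0"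
proof -
  define V where "V i x = F x * partial i R x - R x * partial i F x" for i x
  define W where "W i x = F x * partial i (partial i R) x - R x * partial i (partial i F) x" for i x
  define D where "D i x = cutoff_slope x * (x $ i * V i x) + cutoff x * W i x" for i x
  note sm = F R F[THEN smooth_on_partial] R[THEN smooth_on_partial]
    F[THEN smooth_on_partial, THEN smooth_on_partial] R[THEN smooth_on_partial, THEN smooth_on_partial]
  note ct = sm[THEN smooth_on_imp_continuous_on]
  have V: "continuous_on punctured (V i)" and W: "continuous_on punctured (W i)" for i
    unfolding V_def[abs_def] W_def[abs_def] by (intro continuous_intros ct)+
  have xV: "continuous_on punctured (\<lambda>x. x $ i * V i x)" for i
    using V by (intro continuous_intros) auto
  have DW: "continuous_on UNIV (\<lambda>x. cutoff x * W i x)"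
    "continuous_on UNIV (\<lambda>x. cutoff_slope x * (x $ i * V i x))" for i
    by (intro continuous_on_cutoff_mult continuous_on_cutoff W xV;
        simp add: cutoff_eq_0 cutoff_slope_eq_0)+
  have D0: "(\<integral>x. D i x \<partial>lborel) = 0" for i
  proof (rule integral_directional_derivative_eq_0[where G = "\<lambda>x. cutoff x * V i x" and e = "axis i 1" and r = 2])
    show "continuous_on UNIV (\<lambda>x. cutoff x * V i x)"
      using V by (intro continuous_on_cutoff_mult continuous_on_cutoff) (auto simp: cutoff_eq_0)
    show "continuous_on UNIV (D i)"
      unfolding D_def[abs_def] by (intro continuous_on_add DW)
    show "cutoff x * V i x = 0" if "norm x > 2" for x
      using that by (simp add: cutoff_eq_0)
    show "((\<lambda>t. cutoff (x + t *\<^sub>R axis i 1) * V i (x + t *\<^sub>R axis i 1)) has_real_derivative D i x) (at 0)" for x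
    \<comment> \<open>Nothing is known about the functions at the origin, but the cutoff vanishes around it.\<close>
    proof (cases "x = 0")
      case True
      have "((\<lambda>_. 0::real) has_real_derivative 0) (at 0)"
        by simp
      then have "((\<lambda>t. cutoff (x + t *\<^sub>R axis i 1) * V i (x + t *\<^sub>R axis i 1)) has_real_derivative 0) (at 0)"
        by (rule has_field_derivative_transform_within_open[of _ _ _ "ball 0 1"])
           (auto simp: True cutoff_eq_0)
      then show ?thesis
        using True by (simp add: D_def cutoff_eq_0)
    next
      case False
      have df: "g differentiable at (x + 0 *\<^sub>R axis i 1)" if "smooth_on punctured g" for g
        using smooth_on_imp_differentiable[OF open_punctured that, of x] False by simp
      have "((\<lambda>t. V i (x + t *\<^sub>R axis i 1)) has_real_derivative W i x) (at 0)"
        unfolding V_def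
        by (rule derivative_eq_intros partial_line_derivative df sm refl)+
           (simp add: W_def algebra_simps)
      from DERIV_mult[OF cutoff_line_derivative this] show ?thesis
        by (rule DERIV_cong) (simp add: D_def algebra_simps)
    qed
  qed
  have Di: "integrable lborel (D i)" for i
    by (rule integrable_lborel_compact_support[where r = 2])
       (auto simp: D_def[abs_def] cutoff_eq_0 cutoff_slope_eq_0 intro!: continuous_on_add DW)
  have "cutoff x * (F x * euclidean_laplacian R x - R x * euclidean_laplacian F x) = (\<Sum>i\<in>UNIV. D i x)" for x
  proof (cases "x = 0")
    case True
    then show ?thesis by (simp add: D_def cutoff_eq_0)
  next
    case False
    have "(\<Sum>i\<in>UNIV. x $ i * V i x) =
       F x * (\<Sum>i\<in>UNIV. x $ i * partial i R x) - R x * (\<Sum>i\<in>UNIV. x $ i * partial i F x)"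
      unfolding V_def by (simp add: sum_3 algebra_simps)
    then have "(\<Sum>i\<in>UNIV. x $ i * V i x) = 0"
      using F0 R0 False by simp
    then have "(\<Sum>i\<in>UNIV. D i x) = cutoff x * (\<Sum>i\<in>UNIV. W i x)"
      unfolding D_def by (simp add: sum.distrib flip: sum_distrib_left)
    then show ?thesis
      by (simp add: euclidean_laplacian_def W_def sum_3 algebra_simps)
  qed
  then show ?thesis
    using D0 Di by simp
qed

section \<open>Eigenfunctions and their moments\<close>

lemma radial_ext_scale: "c > 0 \<Longrightarrow> radial_ext f (c *\<^sub>R x) = radial_ext f x"
  by (simp add: radial_ext_def field_simps)

lemma radial_ext_sphere: "x \<in> S2 \<Longrightarrow> radial_ext f x = f x"
  by (simp add: radial_ext_def)

lemma normalized_in_S2: "x \<noteq> 0 \<Longrightarrow> x /\<^sub>R norm x \<in> S2"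
  by simp

lemma continuous_on_radial_ext:
  assumes "continuous_on S2 f"
  shows "continuous_on punctured (radial_ext f)"
  unfolding radial_ext_def
proof (rule continuous_on_compose2[OF assms])
  show "continuous_on punctured (\<lambda>x. x /\<^sub>R norm x)"
    by (intro continuous_intros) auto
  show "(\<lambda>x. x /\<^sub>R norm x) ` punctured \<subseteq> S2"
    using normalized_in_S2 by blast
qed

lemma continuous_on_S2_if_radial_ext:
  assumes "continuous_on punctured (radial_ext f)"
  shows "continuous_on S2 f"
proof -
  have "continuous_on S2 (radial_ext f)"
    using assms by (rule continuous_on_subset) auto
  then show ?thesis
    by (rule continuous_on_eq) (simp add: radial_ext_sphere)
qed

lemma partial_scale:
  assumes "g differentiable at (c *\<^sub>R x)"
  shows "partial i (\<lambda>y. g (c *\<^sub>R y)) x = c * partial i g (c *\<^sub>R x)"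
proof -
  let ?g' = "frechet_derivative g (at (c *\<^sub>R x))"
  have g': "(g has_derivative ?g') (at (c *\<^sub>R x))"
    using assms frechet_derivative_works by blast
  have "((\<lambda>y. c *\<^sub>R y) has_derivative (\<lambda>h. c *\<^sub>R h)) (at x)"
    by (auto intro!: derivative_eq_intros)
  from has_derivative_compose[OF this g']
  have "partial i (\<lambda>y. g (c *\<^sub>R y)) x = ?g' (c *\<^sub>R axis i 1)"
    by (rule partial_eq_has_derivative)
  then show ?thesis
    using linear_scale[OF has_derivative_linear[OF g'], of c "axis i 1"] by (simp add: partial_def)
qed

text \<open>A function that is constant along rays has a Laplacian that is homogeneous of degree \<open>-2\<close>. This
carries the eigenvalue equation from the sphere to the punctured space.\<close>

lemma laplacian_radial_ext_scale:
  assumes f: "smooth_on punctured (radial_ext f)" and "c > 0" "x \<noteq> 0"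
  shows "euclidean_laplacian (radial_ext f) x = c\<^sup>2 * euclidean_laplacian (radial_ext f) (c *\<^sub>R x)"
proof -
  let ?F = "radial_ext f"
  have diff: "g differentiable at (c *\<^sub>R y)" if "smooth_on punctured g" "y \<noteq> 0" for g y
    using smooth_on_imp_differentiable[OF open_punctured that(1)] that(2) assms(2) by simp
  have first: "partial i ?F y = c * partial i ?F (c *\<^sub>R y) + 0 * 0" if "y \<noteq> 0" for y i
  proof -
    have "partial i ?F y = partial i (\<lambda>y. ?F (c *\<^sub>R y)) y"
      using assms(2) by (simp add: radial_ext_scale)
    then show ?thesis using partial_scale[OF diff[OF f that]] by simp
  qed
  have "partial i (partial i ?F) x = c * (c * partial i (partial i ?F) (c *\<^sub>R x))" for i
  proof -
    have "partial i (partial i ?F) x = partial i (\<lambda>y. c * partial i ?F (c *\<^sub>R y) + 0 * 0) x"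
      using assms(3) first by (intro partial_cong[OF open_punctured]) auto
    also have "\<dots> = c * partial i (\<lambda>y. partial i ?F (c *\<^sub>R y)) x + 0 * partial i (\<lambda>_. 0) x"
    proof (rule partial_linear_combination)
      have "(\<lambda>y. c *\<^sub>R y) differentiable at x" by simp
      then show "(\<lambda>y. partial i ?F (c *\<^sub>R y)) differentiable at x"
        by (rule differentiable_compose[rotated]) (intro diff smooth_on_partial f assms)
    qed simp
    also have "partial i (\<lambda>y. partial i ?F (c *\<^sub>R y)) x = c * partial i (partial i ?F) (c *\<^sub>R x)"
      by (intro partial_scale diff smooth_on_partial f assms)
    finally show ?thesis by simp
  qed
  then show ?thesis
    by (simp add: euclidean_laplacian_def sum_distrib_left power2_eq_square mult_ac)
qed

lemma linear_axis_expansion: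
  fixes L :: "real^3 \<Rightarrow> real"
  assumes "linear L"
  shows "L x = (\<Sum>i\<in>UNIV. x $ i * L (axis i 1))"
proof -
  have "x = (\<Sum>i\<in>UNIV. x $ i *\<^sub>R axis i 1)"
    by (simp add: vec_eq_iff axis_def if_distrib cong: if_cong)
  then have "L x = L (\<Sum>i\<in>UNIV. x $ i *\<^sub>R axis i 1)" by simp
  also have "\<dots> = (\<Sum>i\<in>UNIV. x $ i * L (axis i 1))"
    using assms by (simp add: linear_sum linear_scale)
  finally show ?thesis .
qed

lemma Euler_radial_ext:
  assumes f: "smooth_on punctured (radial_ext f)" and x: "x \<noteq> 0"
  shows "(\<Sum>i\<in>UNIV. x $ i * partial i (radial_ext f) x) = 0"
proof -
  let ?F = "radial_ext f"
  let ?F' = "frechet_derivative ?F (at x)"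
  have F': "(?F has_derivative ?F') (at (x + 0 *\<^sub>R x))"
    using smooth_on_imp_differentiable[OF open_punctured f, of x] x
    by (simp add: frechet_derivative_works[symmetric])
  have "((\<lambda>t. x + t *\<^sub>R x) has_derivative (\<lambda>t. t *\<^sub>R x)) (at 0)"
    by (auto intro!: derivative_eq_intros)
  from has_derivative_compose[OF this F']
  have "((\<lambda>t. ?F (x + t *\<^sub>R x)) has_derivative (\<lambda>t. ?F' (t *\<^sub>R x))) (at 0)" .
  then have "((\<lambda>_. ?F x) has_derivative (\<lambda>t. ?F' (t *\<^sub>R x))) (at (0::real))"
  proof (rule has_derivative_transform_within_open[where s = "ball 0 1"])
    show "?F (x + t *\<^sub>R x) = ?F x" if "t \<in> ball 0 1" for t
      using radial_ext_scale[of "1 + t" f x] that by (simp add: algebra_simps)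
  qed auto
  then have "(\<lambda>t. ?F' (t *\<^sub>R x)) = (\<lambda>t. 0::real)"
    by (rule has_derivative_unique) simp
  then have "?F' (1 *\<^sub>R x) = 0"
    by meson
  moreover have "?F' x = (\<Sum>i\<in>UNIV. x $ i * ?F' (axis i 1))"
    by (rule linear_axis_expansion[OF has_derivative_linear[OF F']])
  ultimately show ?thesis
    by (simp add: partial_def)
qed

lemma eigenspace_smooth: "f \<in> eigenspace \<mu> \<Longrightarrow> smooth_on punctured (radial_ext f)"
  by (simp add: eigenspace_def smooth_on_S2_def)

lemma eigenspace_continuous: "f \<in> eigenspace \<mu> \<Longrightarrow> continuous_on S2 f"
  by (intro continuous_on_S2_if_radial_ext smooth_on_imp_continuous_on eigenspace_smooth)

lemma eigenspace_laplacian: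
  assumes "f \<in> eigenspace \<mu>" "x \<noteq> 0"
  shows "euclidean_laplacian (radial_ext f) x = - \<mu> * inverse (norm x) ^ 2 * radial_ext f x"
proof -
  have "euclidean_laplacian (radial_ext f) x =
      inverse (norm x) ^ 2 * euclidean_laplacian (radial_ext f) (x /\<^sub>R norm x)"
    using assms by (intro laplacian_radial_ext_scale eigenspace_smooth) auto
  moreover have "- euclidean_laplacian (radial_ext f) (x /\<^sub>R norm x) = \<mu> * radial_ext f x"
    using assms normalized_in_S2[OF assms(2)]
    unfolding eigenspace_def laplace_beltrami_def radial_ext_def by blast
  then have "euclidean_laplacian (radial_ext f) (x /\<^sub>R norm x) = - \<mu> * radial_ext f x"
    by linarith
  ultimately show ?thesis by simp
qed

lemma radial_ext_monomial: "x \<noteq> 0 \<Longrightarrow> radial_ext (monomial \<alpha>) x = ray_monomial \<alpha> x"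
  by (simp add: radial_ext_def monomial_def scaled_monomial_def power_mult_distrib prod.distrib
      power_sum deg_def mult.commute)

lemma smooth_radial_ext_monomial: "smooth_on punctured (radial_ext (monomial \<alpha>))"
  using smooth_on_cong[OF open_punctured, of "radial_ext (monomial \<alpha>)" "ray_monomial \<alpha>"]
  by (simp add: radial_ext_monomial smooth_scaled_monomial)

text \<open>In polar coordinates the radial weight separates, so this is a positive multiple of the inner
  product of square integrable functions on the sphere. The weight \<open>r\<^sup>-\<^sup>2\<close> is the homogeneity factor
  of the Laplacian of a radial extension.\<close>

definition sphere_inner :: "(real^3 \<Rightarrow> real) \<Rightarrow> (real^3 \<Rightarrow> real) \<Rightarrow> real" where
  "sphere_inner f g =
    (\<integral>x. cutoff x * (inverse (norm x) ^ 2 * (radial_ext f x * radial_ext g x)) \<partial>lborel)"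

lemma sphere_inner_integrable:
  assumes "continuous_on S2 f" "continuous_on S2 g"
  shows "integrable lborel (\<lambda>x. cutoff x * (inverse (norm x) ^ 2 * (radial_ext f x * radial_ext g x)))"
  by (intro integrable_cutoff_mult continuous_intros continuous_on_radial_ext assms) auto

lemma sphere_inner_cong:
  assumes "\<And>x. x \<in> S2 \<Longrightarrow> f x = f' x" "\<And>x. x \<in> S2 \<Longrightarrow> g x = g' x"
  shows "sphere_inner f g = sphere_inner f' g'"
proof -
  have "radial_ext f x = radial_ext f' x \<and> radial_ext g x = radial_ext g' x" if "x \<noteq> 0" for x
    using assms[OF normalized_in_S2[OF that]] by (simp add: radial_ext_def)
  then have "cutoff x * (inverse (norm x) ^ 2 * (radial_ext f x * radial_ext g x)) =
      cutoff x * (inverse (norm x) ^ 2 * (radial_ext f' x * radial_ext g' x))" for x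
    by (cases "x = 0") (auto simp: cutoff_eq_0)
  then show ?thesis
    unfolding sphere_inner_def by (intro Bochner_Integration.integral_cong refl)
qed

lemma sphere_inner_commute: "sphere_inner f g = sphere_inner g f"
  by (simp add: sphere_inner_def mult.commute)

lemma sphere_inner_sum_right:
  assumes "continuous_on S2 f" "\<And>c. c \<in> C \<Longrightarrow> continuous_on S2 (g c)"
  shows "sphere_inner f (\<lambda>x. \<Sum>c\<in>C. u c * g c x) = (\<Sum>c\<in>C. u c * sphere_inner f (g c))"
proof -
  let ?w = "\<lambda>x. cutoff x * inverse (norm x) ^ 2 * radial_ext f x"
  have "sphere_inner f (\<lambda>x. \<Sum>c\<in>C. u c * g c x) =
      (\<integral>x. (\<Sum>c\<in>C. u c * (cutoff x * (inverse (norm x) ^ 2 * (radial_ext f x * radial_ext (g c) x)))) \<partial>lborel)"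
    unfolding sphere_inner_def
    by (intro Bochner_Integration.integral_cong refl) (simp add: radial_ext_def sum_distrib_left mult_ac)
  also have "\<dots> = (\<Sum>c\<in>C. u c * sphere_inner f (g c))"
    unfolding sphere_inner_def
    by (subst Bochner_Integration.integral_sum)
       (auto intro!: integrable_mult_right sphere_inner_integrable[unfolded mult.assoc] assms)
  finally show ?thesis .
qed

lemma sphere_inner_linear_combination_right:
  assumes "continuous_on S2 f" "continuous_on S2 g" "continuous_on S2 h"
  shows "sphere_inner f (\<lambda>x. a * g x + b * h x) = a * sphere_inner f g + b * sphere_inner f h"
  using sphere_inner_sum_right[of f "UNIV :: bool set" "\<lambda>c. if c then g else h" "\<lambda>c. if c then a else b"] assms
  by (simp add: UNIV_bool add.commute)

lemma sphere_inner_nonneg: "0 \<le> sphere_inner f f"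
  unfolding sphere_inner_def by (intro integral_nonneg_AE) (simp add: cutoff_nonneg)

text \<open>The integrand is continuous and nonnegative, so the set where it is positive is open and null,
hence empty; the cutoff is positive on the sphere of radius \<open>3/2\<close>.\<close>

lemma sphere_inner_self_eq_0:
  assumes f: "continuous_on S2 f" and z: "sphere_inner f f = 0" and x: "x \<in> S2"
  shows "f x = 0"
proof (rule ccontr)
  assume fx: "f x \<noteq> 0"
  define h where "h y = cutoff y * (inverse (norm y) ^ 2 * (radial_ext f y * radial_ext f y))" for y
  have h: "continuous_on UNIV h"
    unfolding h_def
    by (intro continuous_on_cutoff_mult continuous_on_cutoff continuous_intros continuous_on_radial_ext f)
       (auto simp: cutoff_eq_0)
  have h0: "0 \<le> h y" for y
    by (simp add: h_def cutoff_nonneg)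
  have "integrable lborel h"
    using sphere_inner_integrable[OF f f] by (simp add: h_def[abs_def])
  moreover have "(\<integral>y. h y \<partial>lborel) = 0"
    using z by (simp add: sphere_inner_def h_def)
  ultimately have "AE y in lborel. h y = 0"
    using integral_nonneg_eq_0_iff_AE[of lborel h] h0 by simp
  moreover have op: "open {y. h y \<noteq> 0}"
    using open_Collect_neq[OF h continuous_on_const] by simp
  ultimately have "{y. h y \<noteq> 0} \<in> null_sets lborel"
    using AE_iff_null[of lborel "\<lambda>y. h y = 0"] by simp
  then have "{y. h y \<noteq> 0} \<in> null_sets lebesgue"
    by (rule null_sets_completionI)
  then have "negligible {y. h y \<noteq> 0}"
    by (simp add: negligible_iff_null_sets)
  moreover have "h ((3/2) *\<^sub>R x) \<noteq> 0"
  proof -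
    have nx: "norm x = 1" using x by simp
    then have "x \<bullet> x = 1" by (simp add: dot_square_norm)
    then have "shell ((3/2) *\<^sub>R x) > 0" by (simp add: shell_def)
    moreover have "radial_ext f ((3/2) *\<^sub>R x) = f x"
      using radial_ext_scale[of "3/2" f x] radial_ext_sphere[OF x] by simp
    ultimately show ?thesis using fx nx by (auto simp: h_def cutoff_def)
  qed
  ultimately show False
    using open_not_negligible[OF op] by blast
qed

lemma continuous_on_monomial: "continuous_on A (monomial \<alpha>)"
  unfolding monomial_def[abs_def] by (intro continuous_intros)

text \<open>Let \<open>Z\<close> be the set of all \<open>g\<close> such that \<open>f\<close> is orthogonal to \<open>g\<close> times every monomial. It is closed
under multiplication by coordinates, hence by all polynomials, and contains 1. So \<open>f\<close> is orthogonal
to every polynomial, and by the Stone-Weierstrass theorem to itself.\<close>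

theorem orthogonal_to_monomials_imp_0:
  assumes f: "continuous_on S2 f" and orth: "\<And>\<alpha>. sphere_inner f (monomial \<alpha>) = 0" and x: "x \<in> S2"
  shows "f x = 0"
proof -
  define Z where "Z = {g. continuous_on UNIV g \<and> (\<forall>\<alpha>. sphere_inner f (\<lambda>x. g x * monomial \<alpha> x) = 0)}"
  have Zlin: "(\<lambda>x. a * g x + b * h x) \<in> Z" if "g \<in> Z" "h \<in> Z" for a b g h
  proof -
    have gh: "continuous_on A g" "continuous_on A h" for A
      using that by (auto simp: Z_def intro: continuous_on_subset)
    have "sphere_inner f (\<lambda>x. (a * g x + b * h x) * monomial \<alpha> x) = 0" for \<alpha>
      using sphere_inner_linear_combination_right[OF f, of "\<lambda>x. g x * monomial \<alpha> x" "\<lambda>x. h x * monomial \<alpha> x" a b]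
        that by (simp add: Z_def gh continuous_on_monomial continuous_on_mult algebra_simps)
    then show ?thesis by (simp add: Z_def gh continuous_on_add continuous_on_mult)
  qed
  have coord: "(\<lambda>x. x $ i * g x) \<in> Z" if "g \<in> Z" for g i
  proof -
    have "(\<lambda>x. x $ i * g x * monomial \<alpha> x) = (\<lambda>x. g x * monomial (raise 1 i \<alpha>) x)" for \<alpha>
      by (simp add: monomial_raise mult_ac del: fun_upd_apply One_nat_def)
    then show ?thesis using that
      by (auto simp: Z_def intro!: continuous_intros simp del: fun_upd_apply One_nat_def)
  qed
  have "(\<lambda>x. q x * g x) \<in> Z" if "real_polynomial_function q" "g \<in> Z" for q g
    using that
  proof (induction q arbitrary: g)
    case (linear q)
    have q: "q x = q (axis 1 1) * x $ 1 + q (axis 2 1) * x $ 2 + q (axis 3 1) * x $ 3" for x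
      using linear_axis_expansion[OF bounded_linear.linear[OF linear.hyps], of x]
      by (simp add: sum_3 mult.commute)
    have eq: "(\<lambda>x. q x * g x) = (\<lambda>x. 1 * (q (axis 1 1) * (x $ 1 * g x) + q (axis 2 1) * (x $ 2 * g x))
        + q (axis 3 1) * (x $ 3 * g x))"
      by (rule ext, subst q) (simp add: algebra_simps)
    show ?case unfolding eq by (intro Zlin coord linear.prems)
  next
    case (const c)
    have "(\<lambda>x. c * g x + 0 * g x) \<in> Z"
      by (intro Zlin const)
    then show ?case by simp
  next
    case (add p q)
    have "(\<lambda>x. 1 * (p x * g x) + 1 * (q x * g x)) \<in> Z"
      by (intro Zlin add)
    then show ?case by (simp add: distrib_right)
  next
    case (mult p q)
    have "(\<lambda>x. p x * (q x * g x)) \<in> Z"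
      by (intro mult)
    then show ?case by (simp add: mult.assoc)
  qed
  moreover have "(\<lambda>_. 1) \<in> Z"
    using orth by (simp add: Z_def)
  ultimately have "(\<lambda>x. q x * 1) \<in> Z" if "real_polynomial_function q" for q
    using that by blast
  then have poly: "sphere_inner f q = 0" "continuous_on S2 q" if "real_polynomial_function q" for q
  proof -
    have "sphere_inner f (\<lambda>x. q x * monomial (\<lambda>_. 0) x) = 0" "continuous_on UNIV q"
      using \<open>\<And>q. real_polynomial_function q \<Longrightarrow> (\<lambda>x. q x * 1) \<in> Z\<close>[OF that] by (auto simp: Z_def)
    then show "sphere_inner f q = 0" "continuous_on S2 q"
      by (auto simp: monomial_def intro: continuous_on_subset)
  qed
  have le: "sphere_inner f f \<le> e * sphere_inner (\<lambda>_. 1) (\<lambda>x. \<bar>f x\<bar>)" if "e > 0" for e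
  proof -
    obtain q where q: "real_polynomial_function q" "\<And>x. x \<in> S2 \<Longrightarrow> \<bar>f x - q x\<bar> < e"
      using Stone_Weierstrass_real_polynomial_function[OF compact_sphere f \<open>e > 0\<close>] by metis
    have "sphere_inner f f = sphere_inner f (\<lambda>x. 1 * f x + (-1) * q x)"
      unfolding sphere_inner_linear_combination_right[OF f f poly(2)[OF q(1)]] using poly[OF q(1)] by simp
    also have "\<dots> \<le> (\<integral>x. e * (cutoff x * (inverse (norm x) ^ 2 *
        (radial_ext (\<lambda>_. 1) x * radial_ext (\<lambda>x. \<bar>f x\<bar>) x))) \<partial>lborel)"
      unfolding sphere_inner_def
    proof (rule integral_mono)
      show "integrable lborel (\<lambda>x. cutoff x * (inverse (norm x) ^ 2 *
          (radial_ext f x * radial_ext (\<lambda>x. 1 * f x + (-1) * q x) x)))"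
        by (intro sphere_inner_integrable continuous_intros f poly q)
      show "integrable lborel (\<lambda>x. e * (cutoff x * (inverse (norm x) ^ 2 *
          (radial_ext (\<lambda>_. 1) x * radial_ext (\<lambda>x. \<bar>f x\<bar>) x))))"
        by (intro integrable_mult_right sphere_inner_integrable continuous_intros f)
      show "cutoff x * (inverse (norm x) ^ 2 * (radial_ext f x * radial_ext (\<lambda>x. 1 * f x + (-1) * q x) x)) \<le>
          e * (cutoff x * (inverse (norm x) ^ 2 * (radial_ext (\<lambda>_. 1) x * radial_ext (\<lambda>x. \<bar>f x\<bar>) x)))" for x
      proof (cases "x = 0")
        case False
        let ?y = "x /\<^sub>R norm x"
        have "f ?y * (f ?y - q ?y) \<le> \<bar>f ?y\<bar> * \<bar>f ?y - q ?y\<bar>"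
          by (metis abs_ge_self abs_mult)
        also have "\<dots> \<le> \<bar>f ?y\<bar> * e"
          using q(2)[OF normalized_in_S2[OF False]] by (intro mult_left_mono) auto
        finally have "(cutoff x * inverse (norm x) ^ 2) * (f ?y * (f ?y - q ?y)) \<le>
            (cutoff x * inverse (norm x) ^ 2) * (\<bar>f ?y\<bar> * e)"
          by (intro mult_left_mono) (auto simp: cutoff_nonneg)
        then show ?thesis by (simp add: radial_ext_def algebra_simps)
      qed (simp add: cutoff_eq_0)
    qed
    also have "\<dots> = e * sphere_inner (\<lambda>_. 1) (\<lambda>x. \<bar>f x\<bar>)"
      by (simp add: sphere_inner_def)
    finally show ?thesis .
  qed
  have "((\<lambda>e. e * sphere_inner (\<lambda>_. 1) (\<lambda>x. \<bar>f x\<bar>)) \<longlongrightarrow> 0 * sphere_inner (\<lambda>_. 1) (\<lambda>x. \<bar>f x\<bar>)) (at_right 0)"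
    by (intro tendsto_intros)
  then have "sphere_inner f f \<le> 0 * sphere_inner (\<lambda>_. 1) (\<lambda>x. \<bar>f x\<bar>)"
    by (rule tendsto_lowerbound)
       (use le in \<open>auto simp: trivial_limit_at_right_real intro: eventually_mono[OF eventually_at_right_less]\<close>)
  then have "sphere_inner f f \<le> 0"
    by simp
  with sphere_inner_nonneg[of f] show ?thesis
    using sphere_inner_self_eq_0[OF f _ x] by simp
qed

text \<open>The Laplacian is symmetric. Moving it from the eigenfunction to the monomial and using its
triangular form there yields a recursion between the moments of \<open>f\<close>.\<close>

lemma sphere_inner_eigenfunction_recursion:
  assumes f: "f \<in> eigenspace \<mu>"
  shows "(\<Sum>i\<in>UNIV. real (\<alpha> i * (\<alpha> i - 1)) * sphere_inner f (monomial (lower 2 i \<alpha>)))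
    + (\<mu> - real (deg \<alpha>) * (real (deg \<alpha>) + 1)) * sphere_inner f (monomial \<alpha>) = 0"
proof -
  let ?F = "radial_ext f" and ?R = "radial_ext (monomial \<alpha>)"
  let ?m = "\<mu> - real (deg \<alpha>) * (real (deg \<alpha>) + 1)"
  let ?I = "\<lambda>\<beta> x. cutoff x * (inverse (norm x) ^ 2 * (?F x * radial_ext (monomial \<beta>) x))"
  have int: "integrable lborel (?I \<beta>)" for \<beta>
    by (intro sphere_inner_integrable eigenspace_continuous[OF f] continuous_on_monomial)
  have "cutoff x * (?F x * euclidean_laplacian ?R x - ?R x * euclidean_laplacian ?F x) =
     (\<Sum>i\<in>UNIV. real (\<alpha> i * (\<alpha> i - 1)) * ?I (lower 2 i \<alpha>) x) + ?m * ?I \<alpha> x" for x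
  proof (cases "x = 0")
    case True
    then show ?thesis by (simp add: cutoff_eq_0)
  next
    case False
    have "euclidean_laplacian ?R x = euclidean_laplacian (ray_monomial \<alpha>) x"
      using False by (intro euclidean_laplacian_cong[OF open_punctured]) (auto simp: radial_ext_monomial)
    then have lap: "euclidean_laplacian ?R x = inverse (norm x) ^ 2 *
        ((\<Sum>i\<in>UNIV. real (\<alpha> i * (\<alpha> i - 1)) * radial_ext (monomial (lower 2 i \<alpha>)) x)
          - real (deg \<alpha>) * (real (deg \<alpha>) + 1) * ?R x)"
      using laplacian_ray_monomial[OF False, of \<alpha>] by (simp only: radial_ext_monomial[OF False])
    have rearrange: "c * (F * (r * (S - N * R)) - R * (- \<mu> * r * F)) = c * r * F * S + (\<mu> - N) * (c * (r * (F * R)))"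
      for c F r S N R :: real
      by (simp add: algebra_simps)
    then show ?thesis
      unfolding eigenspace_laplacian[OF f False] lap rearrange by (simp only: sum_distrib_left mult_ac)
  qed
  moreover have "(\<integral>x. cutoff x * (?F x * euclidean_laplacian ?R x - ?R x * euclidean_laplacian ?F x) \<partial>lborel) = 0"
    by (intro Green_identity_cutoff Euler_radial_ext eigenspace_smooth[OF f] smooth_radial_ext_monomial)
  ultimately show ?thesis
    using int by (simp add: sphere_inner_def)
qed

lemma sphere_inner_monomial_contract:
  assumes "continuous_on S2 f"
  shows "(\<Sum>i\<in>UNIV. sphere_inner f (monomial (raise 2 i \<alpha>))) = sphere_inner f (monomial \<alpha>)"
proof -
  have "(\<Sum>i\<in>UNIV. 1 * sphere_inner f (monomial (raise 2 i \<alpha>))) =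
      sphere_inner f (\<lambda>x. \<Sum>i\<in>UNIV. 1 * monomial (raise 2 i \<alpha>) x)"
    by (rule sphere_inner_sum_right[symmetric]) (auto intro: assms continuous_on_monomial)
  also have "\<dots> = sphere_inner f (monomial \<alpha>)"
  proof (rule sphere_inner_cong)
    show "(\<Sum>i\<in>UNIV. 1 * monomial (raise 2 i \<alpha>) x) = monomial \<alpha> x" if "x \<in> S2" for x
    proof -
      have "(\<Sum>i\<in>UNIV. 1 * monomial (raise 2 i \<alpha>) x) = (\<Sum>i\<in>UNIV. (x $ i)\<^sup>2) * monomial \<alpha> x"
        unfolding monomial_raise by (simp add: sum_distrib_right)
      then show ?thesis using that by (simp add: sum_squares_norm)
    qed
  qed simp
  finally show ?thesis by simp
qed

text \<open>In the degree whose level is \<open>\<mu>\<close> the recursion for the moments says nothing about the moments of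
  that degree. Modulo lower degree, the relation \<open>x\<^sub>3\<^sup>2 = 1 - x\<^sub>1\<^sup>2 - x\<^sub>2\<^sup>2\<close> on the sphere reduces these
  moments to the ones with last exponent at most 1.\<close>

definition critical_exponents :: "real \<Rightarrow> (3 \<Rightarrow> nat) set" where
  "critical_exponents \<mu> = {\<alpha>. real (deg \<alpha>) * (real (deg \<alpha>) + 1) = \<mu> \<and> \<alpha> 3 \<le> 1}"

text \<open>All moments vanish, by induction on the degree \<open>n\<close>. If \<open>n (n + 1) \<noteq> \<mu>\<close> the recursion expresses a
moment of degree \<open>n\<close> by moments of degree \<open>n - 2\<close>. In the critical degree a second induction, on the
last exponent, trades \<open>x\<^sub>3\<^sup>2\<close> for lower degree and smaller last exponent. Both the absence of other
eigenvalues and the upper bound for the multiplicities follow from this.\<close>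

theorem eigenfunction_determined_by_critical_moments:
  assumes f: "f \<in> eigenspace \<mu>"
    and crit: "\<And>\<alpha>. \<alpha> \<in> critical_exponents \<mu> \<Longrightarrow> sphere_inner f (monomial \<alpha>) = 0"
  shows "f = (\<lambda>_. 0)"
proof -
  have "sphere_inner f (monomial \<alpha>) = 0" for \<alpha>
  proof (induction "deg \<alpha>" arbitrary: \<alpha> rule: less_induct)
    case (less \<alpha>0)
    define n where "n = deg \<alpha>0"
    have below: "sphere_inner f (monomial \<beta>) = 0" if "deg \<beta> < n" for \<beta>
      using less that by (simp add: n_def)
    have "sphere_inner f (monomial \<alpha>) = 0" if "deg \<alpha> = n" for \<alpha>
    proof (cases "real n * (real n + 1) = \<mu>")
      case False
      have "real (\<alpha> i * (\<alpha> i - 1)) * sphere_inner f (monomial (lower 2 i \<alpha>)) = 0" for i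
      proof (cases "2 \<le> \<alpha> i")
        case True
        from deg_lower[of 2 \<alpha> i, OF True] that have "deg (lower 2 i \<alpha>) < n" by simp
        then show ?thesis using below by simp
      next
        case False
        then have "\<alpha> i = 0 \<or> \<alpha> i = 1" by auto
        then show ?thesis by auto
      qed
      then have "(\<Sum>i\<in>UNIV. real (\<alpha> i * (\<alpha> i - 1)) * sphere_inner f (monomial (lower 2 i \<alpha>))) = 0"
        by (intro sum.neutral ballI)
      then have "(\<mu> - real n * (real n + 1)) * sphere_inner f (monomial \<alpha>) = 0"
        using sphere_inner_eigenfunction_recursion[OF f, of \<alpha>] that by (simp only: add_0)
      then show ?thesis using False by simp
    next
      case True
      show ?thesis
        using that
      proof (induction "\<alpha> 3" arbitrary: \<alpha> rule: less_induct)
        case (less \<alpha>)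
        show ?case
        proof (cases "2 \<le> \<alpha> 3")
          case False
          then show ?thesis
            using True less.prems by (intro crit) (auto simp: critical_exponents_def)
        next
          case large: True
          define \<beta> where "\<beta> = lower 2 3 \<alpha>"
          have \<beta>: "deg \<beta> + 2 = n"
            using deg_lower[of 2 \<alpha> 3, OF large] less.prems by (simp add: \<beta>_def)
          have "raise 2 3 \<beta> = \<alpha>" using large by (auto simp: \<beta>_def fun_eq_iff)
          moreover have "sphere_inner f (monomial (raise 2 i \<beta>)) = 0" if "i \<noteq> 3" for i
          proof (rule less.hyps)
            show "raise 2 i \<beta> 3 < \<alpha> 3" using that large by (simp add: \<beta>_def)
            show "deg (raise 2 i \<beta>) = n" unfolding deg_raise by (rule \<beta>)
          qed
          moreover have "sphere_inner f (monomial \<beta>) = 0"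
            using \<beta> by (intro below) simp
          moreover have "(1::3) \<noteq> 3" "(2::3) \<noteq> 3" by simp_all
          ultimately show ?thesis
            using sphere_inner_monomial_contract[OF eigenspace_continuous[OF f], of \<beta>]
            by (simp add: sum_3 del: fun_upd_apply)
        qed
      qed
    qed
    then show ?case by (simp add: n_def)
  qed
  then have "f x = 0" if "x \<in> S2" for x
    using orthogonal_to_monomials_imp_0[OF eigenspace_continuous[OF f] _ that] by blast
  moreover have "f x = 0" if "x \<notin> S2" for x
    using f that by (simp add: eigenspace_def)
  ultimately show ?thesis by blast
qed

section \<open>Upper bound for the multiplicities\<close>

interpretation real_fun: vector_space "\<lambda>(c::real) (f::real^3 \<Rightarrow> real) x. c * f x"
  by (rule vector_space_real_fun)

lemma sum_fun_apply: "(\<Sum>c\<in>C. F c) x = (\<Sum>c\<in>C. F c x)"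
  for F :: "'c \<Rightarrow> 'x \<Rightarrow> 'a::comm_monoid_add"
  by (induction C rule: infinite_finite_induct) auto

text \<open>Gaussian elimination: the unknown \<open>d\<close> is eliminated by means of the equation \<open>m\<close>.\<close>

lemma underdetermined_system_has_nontrivial_solution:
  fixes a :: "'m \<Rightarrow> 'c \<Rightarrow> 'f::field"
  assumes "finite M" "finite C" "card M < card C"
  shows "\<exists>u. (\<exists>c\<in>C. u c \<noteq> 0) \<and> (\<forall>m\<in>M. (\<Sum>c\<in>C. u c * a m c) = 0)"
  using assms
proof (induction M arbitrary: C a rule: finite_induct)
  case empty
  then obtain c where "c \<in> C" by (metis card.empty equals0I less_irrefl)
  then show ?case by (intro exI[of _ "\<lambda>_. 1"]) auto
next
  case (insert m M)
  show ?case
  proof (cases "\<forall>c\<in>C. a m c = 0")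
    case True
    obtain u where "\<exists>c\<in>C. u c \<noteq> 0" "\<forall>m\<in>M. (\<Sum>c\<in>C. u c * a m c) = 0"
      using insert.IH[of C a] insert.prems insert.hyps by auto
    then show ?thesis using True by (intro exI[of _ u]) auto
  next
    case False
    then obtain d where d: "d \<in> C" "a m d \<noteq> 0" by blast
    define C' where "C' = C - {d}"
    define a' where "a' n c = a n c - a n d * a m c / a m d" for n c
    have "finite C'" "card M < card C'"
      using insert d by (auto simp: C'_def)
    then obtain u where u: "\<exists>c\<in>C'. u c \<noteq> 0" "\<forall>n\<in>M. (\<Sum>c\<in>C'. u c * a' n c) = 0"
      using insert.IH[of C' a'] by auto
    define s where "s = (\<Sum>c\<in>C'. u c * a m c)"
    define v where "v = u(d := - s / a m d)"
    have sum_v: "(\<Sum>c\<in>C. v c * a n c) = (\<Sum>c\<in>C'. u c * a n c) - s / a m d * a n d" for n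
    proof -
      have "(\<Sum>c\<in>C. v c * a n c) = v d * a n d + (\<Sum>c\<in>C'. v c * a n c)"
        unfolding C'_def using insert.prems(1) d by (simp add: sum.remove)
      moreover have "(\<Sum>c\<in>C'. v c * a n c) = (\<Sum>c\<in>C'. u c * a n c)"
        by (intro sum.cong) (auto simp: v_def C'_def)
      ultimately show ?thesis by (simp add: v_def)
    qed
    have "(\<Sum>c\<in>C. v c * a n c) = 0" if "n \<in> M" for n
    proof -
      have "(\<Sum>c\<in>C'. u c * a' n c) = 0"
        using u(2) that by blast
      then have "0 = (\<Sum>c\<in>C'. u c * a n c - u c * a m c * (a n d / a m d))"
        by (simp add: a'_def algebra_simps)
      also have "\<dots> = (\<Sum>c\<in>C'. u c * a n c) - s * (a n d / a m d)"
        by (simp add: sum_subtractf sum_distrib_right sum_divide_distrib s_def)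
      finally show ?thesis unfolding sum_v by simp
    qed
    moreover have "(\<Sum>c\<in>C. v c * a m c) = 0"
      unfolding sum_v using d by (simp add: s_def)
    moreover have "\<exists>c\<in>C. v c \<noteq> 0"
      using u(1) by (auto simp: v_def C'_def)
    ultimately show ?thesis by auto
  qed
qed

lemma eigenspace_linear_combination:
  assumes "f \<in> eigenspace \<mu>" "g \<in> eigenspace \<mu>"
  shows "(\<lambda>x. a * f x + b * g x) \<in> eigenspace \<mu>"
proof -
  have eq: "radial_ext (\<lambda>x. a * f x + b * g x) = (\<lambda>x. a * radial_ext f x + b * radial_ext g x)"
    by (simp add: radial_ext_def fun_eq_iff)
  have lap: "laplace_beltrami (\<lambda>x. a * f x + b * g x) x = a * laplace_beltrami f x + b * laplace_beltrami g x"
    if "x \<in> S2" for x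
    unfolding laplace_beltrami_def eq using that
    by (intro euclidean_laplacian_linear_combination[OF open_punctured] eigenspace_smooth[OF assms(1)]
        eigenspace_smooth[OF assms(2)]) auto
  have smooth: "smooth_on_S2 (\<lambda>x. a * f x + b * g x)"
    unfolding smooth_on_S2_def eq
    using assms by (intro smooth_on_linear_combination open_punctured eigenspace_smooth)
  have eig: "laplace_beltrami f x = - (\<mu> * f x)" "laplace_beltrami g x = - (\<mu> * g x)"
    if "x \<in> S2" for x
    using assms that unfolding eigenspace_def by force+
  have "- laplace_beltrami (\<lambda>x. a * f x + b * g x) x = \<mu> * (a * f x + b * g x)" if "x \<in> S2" for x
    unfolding lap[OF that] eig[OF that] by (simp add: algebra_simps)
  then show ?thesis
    using assms smooth by (auto simp: eigenspace_def)
qed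

text \<open>The zero function is written as a combination of monomials, so that the smoothness of monomials
applies to it.\<close>

lemma eigenspace_zero: "(\<lambda>_. 0) \<in> eigenspace \<mu>"
proof -
  let ?m = "\<lambda>x. 0 * scaled_monomial (\<lambda>_. 0) 0 x + 0 * scaled_monomial (\<lambda>_. 0) 0 x"
  have eq: "radial_ext (\<lambda>_. 0) = ?m"
    by (simp add: radial_ext_def fun_eq_iff)
  have "smooth_on punctured ?m"
    by (intro smooth_on_linear_combination open_punctured smooth_scaled_monomial)
  moreover have "euclidean_laplacian ?m x = 0" if "x \<in> S2" for x
    using that by (subst euclidean_laplacian_linear_combination[OF open_punctured])
      (auto intro: smooth_scaled_monomial)
  ultimately show ?thesis
    by (simp only: eigenspace_def smooth_on_S2_def laplace_beltrami_def eq mem_Collect_eq) simp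
qed

lemma eigenspace_sum:
  assumes "\<And>f. f \<in> C \<Longrightarrow> f \<in> eigenspace \<mu>"
  shows "(\<lambda>x. \<Sum>f\<in>C. u f * f x) \<in> eigenspace \<mu>"
  using assms
proof (induction C rule: infinite_finite_induct)
  case (insert f C)
  then have "(\<lambda>x. u f * f x + 1 * (\<Sum>f\<in>C. u f * f x)) \<in> eigenspace \<mu>"
    by (intro eigenspace_linear_combination) auto
  then show ?case using insert by simp
qed (simp_all add: eigenspace_zero)

text \<open>With more functions than critical exponents, some nontrivial linear combination would have
vanishing critical moments, hence would be zero.\<close>

lemma eigenspace_independent_card_le:
  assumes C: "C \<subseteq> eigenspace \<mu>" "real_fun.independent C" "finite C"
    and fin: "finite (critical_exponents \<mu>)"
  shows "card C \<le> card (critical_exponents \<mu>)"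
proof (rule ccontr)
  assume "\<not> ?thesis"
  then obtain u where u: "\<exists>f\<in>C. u f \<noteq> 0"
    "\<forall>\<alpha>\<in>critical_exponents \<mu>. (\<Sum>f\<in>C. u f * sphere_inner f (monomial \<alpha>)) = 0"
    using underdetermined_system_has_nontrivial_solution[OF fin C(3), of "\<lambda>\<alpha> f. sphere_inner f (monomial \<alpha>)"]
    by (auto simp: not_le)
  let ?g = "\<lambda>x. \<Sum>f\<in>C. u f * f x"
  have "?g \<in> eigenspace \<mu>"
    using C by (intro eigenspace_sum) auto
  moreover have "sphere_inner ?g (monomial \<alpha>) = (\<Sum>f\<in>C. u f * sphere_inner f (monomial \<alpha>))" for \<alpha>
    unfolding sphere_inner_commute[of _ "monomial \<alpha>"]
    using C(1) by (intro sphere_inner_sum_right continuous_on_monomial) (auto intro: eigenspace_continuous)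
  ultimately have "?g = (\<lambda>_. 0)"
    using u(2) by (intro eigenfunction_determined_by_critical_moments) auto
  then have "(\<Sum>f\<in>C. (\<lambda>x. u f * f x)) = 0"
    by (simp add: fun_eq_iff sum_fun_apply)
  then have "\<forall>f\<in>C. u f = 0"
    using real_fun.independentD[OF C(2,3) subset_refl] by blast
  with u(1) show False by blast
qed

section \<open>Spherical harmonics\<close>

text \<open>The exponents that can occur in a spherical harmonic of degree \<open>l\<close> below its leading monomial.
  Keeping the parity of \<open>l\<close> is what makes a combination of them, multiplied by \<open>r\<^sup>l\<close>, a homogeneous
  polynomial divisible by \<open>r\<^sup>2\<close>.\<close>

definition tail_exponents :: "nat \<Rightarrow> (3 \<Rightarrow> nat) set" where
  "tail_exponents l = {\<beta>. \<exists>j\<ge>1. deg \<beta> + 2 * j = l}"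

definition tail_span :: "nat \<Rightarrow> (real^3 \<Rightarrow> real) set" where
  "tail_span l = real_fun.span (ray_monomial ` tail_exponents l)"

lemma tail_span_linear_combination:
  assumes "f \<in> tail_span l" "g \<in> tail_span l"
  shows "(\<lambda>x. a * f x + b * g x) \<in> tail_span l"
proof -
  have "(\<lambda>x. a * f x) + (\<lambda>x. b * g x) \<in> tail_span l"
    using assms unfolding tail_span_def by (intro real_fun.span_add real_fun.span_scale)
  then show ?thesis by (simp add: plus_fun_def)
qed

lemma tail_span_induct [consumes 1, case_names zero step]:
  assumes "g \<in> tail_span l" "P (\<lambda>_. 0)"
    "\<And>c \<beta> g. \<beta> \<in> tail_exponents l \<Longrightarrow> P g \<Longrightarrow> P (\<lambda>x. c * ray_monomial \<beta> x + 1 * g x)"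
  shows "P g"
  using assms(1) unfolding tail_span_def
proof (induction rule: real_fun.span_induct_alt)
  case base
  then show ?case using assms(2) by (simp add: zero_fun_def)
next
  case (step c f g)
  then show ?case using assms(3)[of _ g c] by (auto simp: plus_fun_def)
qed

lemma tail_span_smooth: "g \<in> tail_span l \<Longrightarrow> smooth_on punctured g"
proof (induction rule: tail_span_induct)
  case zero
  have "smooth_on punctured (\<lambda>x. 0 * scaled_monomial (\<lambda>_. 0) 0 x + 0 * scaled_monomial (\<lambda>_. 0) 0 x)"
    by (intro smooth_on_linear_combination open_punctured smooth_scaled_monomial)
  then show ?case by simp
next
  case (step c \<beta> g)
  then show ?case by (intro smooth_on_linear_combination open_punctured smooth_scaled_monomial)
qed

lemma ray_monomial_normalize: "x \<noteq> 0 \<Longrightarrow> ray_monomial \<beta> (x /\<^sub>R norm x) = ray_monomial \<beta> x"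
  using radial_ext_monomial[of x \<beta>] radial_ext_monomial[of "x /\<^sub>R norm x" \<beta>]
    radial_ext_scale[of "inverse (norm x)" "monomial \<beta>" x] by simp

lemma tail_span_normalize:
  assumes "g \<in> tail_span l" "x \<noteq> 0"
  shows "g (x /\<^sub>R norm x) = g x"
  using assms(1)
proof (induction rule: tail_span_induct)
  case (step c \<beta> g)
  then show ?case by (simp only: ray_monomial_normalize[OF assms(2)])
qed simp

text \<open>For functions that are constant along rays the zeros of this operator are the eigenfunctions of
  level \<open>l\<close>.\<close>

definition shifted_laplacian :: "nat \<Rightarrow> (real^3 \<Rightarrow> real) \<Rightarrow> real^3 \<Rightarrow> real" where
  "shifted_laplacian l g x = (norm x)\<^sup>2 * euclidean_laplacian g x + real l * (real l + 1) * g x"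

lemma shifted_laplacian_linear_combination:
  assumes "smooth_on punctured f" "smooth_on punctured g" "x \<noteq> 0"
  shows "shifted_laplacian l (\<lambda>x. a * f x + b * g x) x =
    a * shifted_laplacian l f x + b * shifted_laplacian l g x"
  unfolding shifted_laplacian_def
  using euclidean_laplacian_linear_combination[OF open_punctured assms(1,2), of x a b] assms(3)
  by (simp add: algebra_simps)

text \<open>The Euclidean Laplacian of the monomial itself, rescaled to be constant along rays. It is the
  part of lower degree in the Laplacian of \<open>ray_monomial \<alpha>\<close>.\<close>

definition descent :: "(3 \<Rightarrow> nat) \<Rightarrow> real^3 \<Rightarrow> real" where
  "descent \<alpha> x = (\<Sum>i\<in>UNIV. real (\<alpha> i * (\<alpha> i - 1)) * ray_monomial (lower 2 i \<alpha>) x)"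

lemma shifted_laplacian_ray_monomial:
  assumes "x \<noteq> 0"
  shows "shifted_laplacian l (ray_monomial \<alpha>) x = descent \<alpha> x +
    (real l * (real l + 1) - real (deg \<alpha>) * (real (deg \<alpha>) + 1)) * ray_monomial \<alpha> x"
proof -
  have cancel: "(norm x)\<^sup>2 * (inverse (norm x) ^ 2 * A) = A" for A
    using assms by (simp add: field_simps)
  show ?thesis
    unfolding shifted_laplacian_def laplacian_ray_monomial[OF assms] cancel descent_def[symmetric]
    by (simp add: algebra_simps)
qed

lemma level_inj: "real m * (real m + 1) = real l * (real l + 1) \<longleftrightarrow> m = l"
proof
  assume "real m * (real m + 1) = real l * (real l + 1)"
  then have "(real m - real l) * (real m + real l + 1) = 0"
    by (simp add: algebra_simps)
  then show "m = l" by (auto simp: add_eq_0_iff_both_eq_0)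
qed simp

text \<open>A preimage of the descent of a leading monomial is what has to be subtracted from that monomial
  to make it an eigenfunction.\<close>

definition solvable :: "nat \<Rightarrow> (real^3 \<Rightarrow> real) \<Rightarrow> bool" where
  "solvable l h \<longleftrightarrow> (\<exists>g\<in>tail_span l. \<forall>x. x \<noteq> 0 \<longrightarrow> shifted_laplacian l g x = h x)"

lemma solvable_linear_combination:
  assumes "solvable l f" "solvable l g"
  shows "solvable l (\<lambda>x. a * f x + b * g x)"
proof -
  obtain f' g' where f': "f' \<in> tail_span l" "\<forall>x. x \<noteq> 0 \<longrightarrow> shifted_laplacian l f' x = f x"
    and g': "g' \<in> tail_span l" "\<forall>x. x \<noteq> 0 \<longrightarrow> shifted_laplacian l g' x = g x"
    using assms unfolding solvable_def by blast
  show ?thesis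
    unfolding solvable_def
    by (rule bexI[of _ "\<lambda>x. a * f' x + b * g' x"])
       (use f' g' in \<open>auto simp: shifted_laplacian_linear_combination tail_span_smooth
          intro: tail_span_linear_combination\<close>)
qed

lemma solvable_zero: "solvable l (\<lambda>_. 0)"
proof -
  have zero: "(\<lambda>_. 0) \<in> tail_span l"
    unfolding tail_span_def using real_fun.span_zero by (simp add: zero_fun_def)
  have "shifted_laplacian l (\<lambda>_. 0) x = 0" if "x \<noteq> 0" for x
    using shifted_laplacian_linear_combination[OF tail_span_smooth[OF zero] tail_span_smooth[OF zero] that, of l 0 0]
    by simp
  then show ?thesis using zero unfolding solvable_def by blast
qed

lemma solvable_descent:
  assumes "deg \<alpha> = l \<or> \<alpha> \<in> tail_exponents l"
    and "\<And>\<beta>. \<beta> \<in> tail_exponents l \<Longrightarrow> deg \<beta> < deg \<alpha> \<Longrightarrow> solvable l (ray_monomial \<beta>)"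
  shows "solvable l (descent \<alpha>)"
proof -
  have step: "solvable l (\<lambda>x. real (\<alpha> i * (\<alpha> i - 1)) * ray_monomial (lower 2 i \<alpha>) x)" for i
  proof (cases "2 \<le> \<alpha> i")
    case True
    from deg_lower[of 2 \<alpha> i, OF True] have d: "deg (lower 2 i \<alpha>) + 2 = deg \<alpha>" .
    have "\<exists>j\<ge>1. deg (lower 2 i \<alpha>) + 2 * j = l"
      using assms(1)
    proof
      assume "deg \<alpha> = l"
      then show ?thesis using d by (intro exI[of _ 1]) auto
    next
      assume "\<alpha> \<in> tail_exponents l"
      then obtain j where "deg \<alpha> + 2 * j = l" by (auto simp: tail_exponents_def)
      then show ?thesis using d by (intro exI[of _ "j + 1"]) auto
    qed
    then have "solvable l (ray_monomial (lower 2 i \<alpha>))"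
      using d by (intro assms(2)) (auto simp: tail_exponents_def)
    from solvable_linear_combination[OF this solvable_zero, of "real (\<alpha> i * (\<alpha> i - 1))" 0]
    show ?thesis by simp
  next
    case False
    then have "\<alpha> i * (\<alpha> i - 1) = 0" by auto
    then show ?thesis using solvable_zero by (simp only: of_nat_0 mult_zero_left)
  qed
  have "solvable l (\<lambda>x. 1 * (1 * (real (\<alpha> 1 * (\<alpha> 1 - 1)) * ray_monomial (lower 2 1 \<alpha>) x) +
      1 * (real (\<alpha> 2 * (\<alpha> 2 - 1)) * ray_monomial (lower 2 2 \<alpha>) x)) +
      1 * (real (\<alpha> 3 * (\<alpha> 3 - 1)) * ray_monomial (lower 2 3 \<alpha>) x))"
    by (intro solvable_linear_combination step)
  then show ?thesis unfolding descent_def[abs_def] sum_3 by (simp only: mult_1)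
qed

text \<open>The shifted Laplacian is triangular on the tail span, and its diagonal entries
\<open>l (l + 1) - n (n + 1)\<close> with \<open>n < l\<close> do not vanish; so it is surjective there, by induction on the
degree.\<close>

lemma solvable_tail: "\<beta> \<in> tail_exponents l \<Longrightarrow> solvable l (ray_monomial \<beta>)"
proof (induction "deg \<beta>" arbitrary: \<beta> rule: less_induct)
  case (less \<beta>)
  have "solvable l (descent \<beta>)"
    using less by (intro solvable_descent) auto
  define k where "k = real l * (real l + 1) - real (deg \<beta>) * (real (deg \<beta>) + 1)"
  have "deg \<beta> \<noteq> l" using less.prems by (auto simp: tail_exponents_def)
  then have k: "k \<noteq> 0" using level_inj[of "deg \<beta>" l] by (auto simp: k_def)
  have "ray_monomial \<beta> \<in> tail_span l"
    unfolding tail_span_def using less.prems by (intro real_fun.span_base) auto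
  then have "solvable l (\<lambda>x. descent \<beta> x + k * ray_monomial \<beta> x)"
    using shifted_laplacian_ray_monomial unfolding solvable_def k_def by blast
  from solvable_linear_combination[OF this \<open>solvable l (descent \<beta>)\<close>, of "1 / k" "- 1 / k"]
  show ?case using k by (simp add: algebra_simps add_divide_distrib)
qed

text \<open>For the leading monomial the diagonal entry is zero, and its descent can be cancelled from the tail
span.\<close>

lemma harmonic_correction:
  assumes "deg \<alpha> = l"
  shows "\<exists>g\<in>tail_span l. \<forall>x. x \<noteq> 0 \<longrightarrow> shifted_laplacian l (\<lambda>x. 1 * ray_monomial \<alpha> x + (-1) * g x) x = 0"
proof -
  have "solvable l (descent \<alpha>)"
    using assms by (intro solvable_descent solvable_tail) auto
  then obtain g where g: "g \<in> tail_span l" "\<forall>x. x \<noteq> 0 \<longrightarrow> shifted_laplacian l g x = descent \<alpha> x"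
    unfolding solvable_def by blast
  have "shifted_laplacian l (\<lambda>x. 1 * ray_monomial \<alpha> x + (-1) * g x) x = 0" if "x \<noteq> 0" for x
    using shifted_laplacian_linear_combination[OF smooth_scaled_monomial tail_span_smooth[OF g(1)] that, of l 1 \<alpha> "deg \<alpha>" "-1"]
      g(2) shifted_laplacian_ray_monomial[OF that, of l \<alpha>] that assms
    by simp
  with g(1) show ?thesis by blast
qed

definition correction :: "(3 \<Rightarrow> nat) \<Rightarrow> real^3 \<Rightarrow> real" where
  "correction \<alpha> = (SOME g. g \<in> tail_span (deg \<alpha>) \<and>
     (\<forall>x. x \<noteq> 0 \<longrightarrow> shifted_laplacian (deg \<alpha>) (\<lambda>x. 1 * ray_monomial \<alpha> x + (-1) * g x) x = 0))"

lemma correction: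
  "correction \<alpha> \<in> tail_span (deg \<alpha>)"
  "x \<noteq> 0 \<Longrightarrow> shifted_laplacian (deg \<alpha>) (\<lambda>x. 1 * ray_monomial \<alpha> x + (-1) * correction \<alpha> x) x = 0"
  using someI_ex[OF harmonic_correction[OF refl, of \<alpha>, unfolded Bex_def]]
  unfolding correction_def by blast+

definition spherical_harmonic :: "(3 \<Rightarrow> nat) \<Rightarrow> real^3 \<Rightarrow> real" where
  "spherical_harmonic \<alpha> x = (if x \<in> S2 then ray_monomial \<alpha> x - correction \<alpha> x else 0)"

text \<open>Both the leading monomial and the correction are constant along rays, so their difference is the
radial extension of its restriction to the sphere.\<close>

lemma spherical_harmonic_in_eigenspace:
  "spherical_harmonic \<alpha> \<in> eigenspace (real (deg \<alpha>) * (real (deg \<alpha>) + 1))"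
proof -
  let ?h = "\<lambda>x. 1 * ray_monomial \<alpha> x + (-1) * correction \<alpha> x"
  have ext: "radial_ext (spherical_harmonic \<alpha>) x = ?h x" if "x \<noteq> 0" for x
    using normalized_in_S2[OF that] ray_monomial_normalize[OF that, of \<alpha>] tail_span_normalize[OF correction(1) that]
    by (simp add: radial_ext_def spherical_harmonic_def)
  have "smooth_on punctured ?h"
    by (intro smooth_on_linear_combination open_punctured smooth_scaled_monomial tail_span_smooth[OF correction(1)])
  then have "smooth_on_S2 (spherical_harmonic \<alpha>)"
    unfolding smooth_on_S2_def using smooth_on_cong[OF open_punctured, of "radial_ext (spherical_harmonic \<alpha>)" ?h] ext
    by simp
  moreover have "- laplace_beltrami (spherical_harmonic \<alpha>) x =
      real (deg \<alpha>) * (real (deg \<alpha>) + 1) * spherical_harmonic \<alpha> x" if "x \<in> S2" for x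
  proof -
    have x: "x \<noteq> 0" "norm x = 1" using that by auto
    have "laplace_beltrami (spherical_harmonic \<alpha>) x = euclidean_laplacian ?h x"
      unfolding laplace_beltrami_def using x ext by (intro euclidean_laplacian_cong[OF open_punctured]) auto
    moreover have "?h x = spherical_harmonic \<alpha> x"
      using that by (simp add: spherical_harmonic_def)
    ultimately show ?thesis
      using correction(2)[OF x(1), of \<alpha>] x(2) unfolding shifted_laplacian_def by simp
  qed
  ultimately show ?thesis
    by (auto simp: eigenspace_def spherical_harmonic_def)
qed

definition exponent :: "nat \<Rightarrow> nat \<Rightarrow> nat \<Rightarrow> (3 \<Rightarrow> nat)" where
  "exponent a b c = (\<lambda>i. if i = 1 then a else if i = 2 then b else c)"

lemma exponent_simps [simp]:
  "exponent a b c 1 = a" "exponent a b c 2 = b" "exponent a b c 3 = c"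
  by (simp_all add: exponent_def)

lemma exponent_inject [simp]: "exponent a b c = exponent a' b' c' \<longleftrightarrow> a = a' \<and> b = b' \<and> c = c'"
  by (auto simp: fun_eq_iff forall_3)

lemma deg_exponent: "deg (exponent a b c) = a + b + c"
  by (simp add: deg_def sum_3)

lemma exponent_surj: "\<alpha> = exponent (\<alpha> 1) (\<alpha> 2) (\<alpha> 3)"
  by (simp add: fun_eq_iff forall_3)

text \<open>Listing the critical exponents by their first entry shows that there are \<open>(l + 1) + l\<close> of them, and
  turns sums over them into polynomials in one variable.\<close>

definition leading_exponents :: "nat \<Rightarrow> (3 \<Rightarrow> nat) set" where
  "leading_exponents l = (\<lambda>k. exponent k (l - k) 0) ` {..l} \<union> (\<lambda>k. exponent k (l - 1 - k) 1) ` {..<l}"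

lemma critical_exponents_level: "critical_exponents (real l * (real l + 1)) = leading_exponents l"
proof -
  have "\<alpha> \<in> leading_exponents l \<longleftrightarrow> deg \<alpha> = l \<and> \<alpha> 3 \<le> 1" for \<alpha>
  proof
    assume "\<alpha> \<in> leading_exponents l"
    then show "deg \<alpha> = l \<and> \<alpha> 3 \<le> 1"
      by (auto simp: leading_exponents_def deg_exponent)
  next
    assume \<alpha>: "deg \<alpha> = l \<and> \<alpha> 3 \<le> 1"
    have l: "\<alpha> 1 + \<alpha> 2 + \<alpha> 3 = l" using \<alpha> by (simp add: deg_def sum_3)
    consider "\<alpha> 3 = 0" | "\<alpha> 3 = 1" using \<alpha> by linarith
    then show "\<alpha> \<in> leading_exponents l"
    proof cases
      case 1
      then have "\<alpha> 2 = l - \<alpha> 1" using l by simp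
      then have "\<alpha> = exponent (\<alpha> 1) (l - \<alpha> 1) 0" using exponent_surj[of \<alpha>] 1 by metis
      then show ?thesis unfolding leading_exponents_def using l by auto
    next
      case 2
      then have "\<alpha> 2 = l - 1 - \<alpha> 1" "\<alpha> 1 < l" using l by simp_all
      moreover from this have "\<alpha> = exponent (\<alpha> 1) (l - 1 - \<alpha> 1) 1" using exponent_surj[of \<alpha>] 2 by metis
      ultimately show ?thesis unfolding leading_exponents_def by blast
    qed
  qed
  then show ?thesis
    unfolding critical_exponents_def level_inj by blast
qed

lemma critical_exponents_empty:
  "\<mu> \<notin> range (\<lambda>l::nat. real l * (real l + 1)) \<Longrightarrow> critical_exponents \<mu> = {}"
  by (auto simp: critical_exponents_def)

lemma sum_leading_exponents:
  "(\<Sum>\<alpha>\<in>leading_exponents l. h \<alpha>) =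
    (\<Sum>k\<le>l. h (exponent k (l - k) 0)) + (\<Sum>k<l. h (exponent k (l - 1 - k) 1))"
proof -
  have "(\<Sum>\<alpha>\<in>leading_exponents l. h \<alpha>) =
      (\<Sum>\<alpha>\<in>(\<lambda>k. exponent k (l - k) 0) ` {..l}. h \<alpha>) + (\<Sum>\<alpha>\<in>(\<lambda>k. exponent k (l - 1 - k) 1) ` {..<l}. h \<alpha>)"
    unfolding leading_exponents_def by (rule sum.union_disjoint) auto
  then show ?thesis by (simp add: sum.reindex inj_on_def)
qed

lemma finite_leading_exponents: "finite (leading_exponents l)"
  by (simp add: leading_exponents_def)

lemma card_leading_exponents: "card (leading_exponents l) = 2 * l + 1"
  using sum_leading_exponents[of "\<lambda>_. 1::nat" l] by (simp only: sum_constant card_atMost card_lessThan) simp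

abbreviation vec3 :: "real \<Rightarrow> real \<Rightarrow> real \<Rightarrow> real^3" where
  "vec3 a b c \<equiv> vector [a, b, c]"

lemma monomial_vec3: "monomial \<alpha> (vec3 a b c) = a ^ \<alpha> 1 * b ^ \<alpha> 2 * c ^ \<alpha> 3"
  unfolding monomial_def UNIV_3 by (simp add: mult.assoc)

lemma norm_vec3: "(norm (vec3 a b c))\<^sup>2 = a\<^sup>2 + b\<^sup>2 + c\<^sup>2"
  using sum_squares_norm[of "vec3 a b c"] by (simp add: sum_3)

lemma vec3_nonzero: "b \<noteq> 0 \<Longrightarrow> vec3 a b c \<noteq> 0"
  by (metis vector_3(2) zero_index)

text \<open>After multiplication by \<open>r\<^sup>l\<close> a function of the tail span is a polynomial multiple of
\<open>r\<^sup>2 = a\<^sup>2 + 1 + z\<^sup>2\<close>. It suffices to see this on the vertical lines through the points \<open>(a, 1, 0)\<close>,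
where polynomials in one variable are enough and the origin is avoided.\<close>

lemma tail_span_divisible:
  assumes "g \<in> tail_span l"
  shows "\<exists>p. \<forall>z. norm (vec3 a 1 z) ^ l * g (vec3 a 1 z) = poly ([:a\<^sup>2 + 1, 0, 1:] * p) z"
  using assms
proof (induction rule: tail_span_induct)
  case zero
  then show ?case by (intro exI[of _ 0]) simp
next
  case (step c \<beta> g)
  then obtain p where p: "norm (vec3 a 1 z) ^ l * g (vec3 a 1 z) = poly ([:a\<^sup>2 + 1, 0, 1:] * p) z" for z
    by blast
  obtain j where j: "j \<ge> 1" "deg \<beta> + 2 * j = l"
    using step by (auto simp: tail_exponents_def)
  define q where "q = smult (c * a ^ \<beta> 1) ([:a\<^sup>2 + 1, 0, 1:] ^ (j - 1) * monom 1 (\<beta> 3))"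
  have "norm (vec3 a 1 z) ^ l * (c * ray_monomial \<beta> (vec3 a 1 z)) = poly ([:a\<^sup>2 + 1, 0, 1:] * q) z" for z
  proof -
    let ?v = "vec3 a 1 z"
    have "norm ?v ^ l = ((norm ?v)\<^sup>2) ^ j * norm ?v ^ deg \<beta>"
      unfolding j(2)[symmetric] by (simp add: power_add power_mult)
    moreover have "norm ?v ^ deg \<beta> * inverse (norm ?v) ^ deg \<beta> = 1"
      using vec3_nonzero[of 1 a z] by (simp add: power_inverse)
    ultimately have "norm ?v ^ l * ray_monomial \<beta> ?v = ((norm ?v)\<^sup>2) ^ j * monomial \<beta> ?v"
      by (simp add: scaled_monomial_def)
    moreover have "((norm ?v)\<^sup>2) ^ j = (a\<^sup>2 + 1 + z\<^sup>2) * (a\<^sup>2 + 1 + z\<^sup>2) ^ (j - 1)"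
      unfolding norm_vec3 using j(1) by (cases j) auto
    ultimately show ?thesis
      by (simp add: q_def monomial_vec3 poly_monom power2_eq_square algebra_simps)
  qed
  then have "norm (vec3 a 1 z) ^ l * (c * ray_monomial \<beta> (vec3 a 1 z) + 1 * g (vec3 a 1 z)) =
      poly ([:a\<^sup>2 + 1, 0, 1:] * (q + p)) z" for z
    unfolding distrib_left poly_add using p by simp
  then show ?case by blast
qed

lemma linear_poly_divisible_by_quadratic_imp_0:
  fixes A B C :: real
  assumes "\<And>z. A + B * z = poly ([:C, 0, 1:] * p) z"
  shows "A = 0 \<and> B = 0"
proof -
  have "poly [:A, B:] = poly ([:C, 0, 1:] * p)"
    using assms by (intro ext) (simp add: mult.commute)
  then have eq: "[:A, B:] = [:C, 0, 1:] * p"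
    by (simp only: poly_eq_poly_eq_iff)
  have "p = 0"
  proof (rule ccontr)
    assume "p \<noteq> 0"
    then have "degree ([:C, 0, 1:] * p) = 2 + degree p"
      by (subst degree_mult_eq) auto
    moreover have "degree [:A, B:] \<le> 1" by simp
    ultimately show False using eq by simp
  qed
  then show ?thesis using eq by simp
qed

text \<open>A vanishing linear combination equates the combination of the leading monomials with an element of
the tail span. On a vertical line, after multiplication by \<open>r\<^sup>l\<close>, the former has degree at most 1 in
\<open>z\<close> and the latter is divisible by \<open>a\<^sup>2 + 1 + z\<^sup>2\<close>, so both vanish; the coefficients are then read off from polynomials in \<open>a\<close>.\<close>

lemma spherical_harmonics_scalars_zero:
  assumes zero: "\<And>x. (\<Sum>\<alpha>\<in>leading_exponents l. c \<alpha> * spherical_harmonic \<alpha> x) = 0"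
    and \<alpha>: "\<alpha> \<in> leading_exponents l"
  shows "c \<alpha> = 0"
proof -
  have degl: "deg \<alpha> = l" if "\<alpha> \<in> leading_exponents l" for \<alpha>
    using that by (auto simp: leading_exponents_def deg_exponent)
  define q where "q x = (\<Sum>\<alpha>\<in>leading_exponents l. c \<alpha> * correction \<alpha> x)" for x
  have "(\<lambda>x. c \<alpha> * correction \<alpha> x) \<in> tail_span l" if "\<alpha> \<in> leading_exponents l" for \<alpha>
    using correction(1)[of \<alpha>] degl[OF that] unfolding tail_span_def
    by (intro real_fun.span_scale[of "correction \<alpha>" _ "c \<alpha>"]) simp
  then have "(\<Sum>\<alpha>\<in>leading_exponents l. (\<lambda>x. c \<alpha> * correction \<alpha> x)) \<in> tail_span l"
    unfolding tail_span_def by (intro real_fun.span_sum)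
  moreover have "(\<Sum>\<alpha>\<in>leading_exponents l. (\<lambda>x. c \<alpha> * correction \<alpha> x)) = q"
    by (simp add: fun_eq_iff sum_fun_apply q_def)
  ultimately have q: "q \<in> tail_span l" by simp
  have ray: "(\<Sum>\<alpha>\<in>leading_exponents l. c \<alpha> * ray_monomial \<alpha> x) = q x" if "x \<noteq> 0" for x
  proof -
    let ?y = "x /\<^sub>R norm x"
    have "0 = (\<Sum>\<alpha>\<in>leading_exponents l. c \<alpha> * (ray_monomial \<alpha> ?y - correction \<alpha> ?y))"
      using zero[of ?y] normalized_in_S2[OF that] by (simp add: spherical_harmonic_def)
    also have "\<dots> = (\<Sum>\<alpha>\<in>leading_exponents l. c \<alpha> * ray_monomial \<alpha> ?y) - q ?y"
      by (simp add: q_def right_diff_distrib sum_subtractf)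
    finally show ?thesis
      using ray_monomial_normalize[OF that] tail_span_normalize[OF q that] by simp
  qed
  have mono: "(\<Sum>\<alpha>\<in>leading_exponents l. c \<alpha> * monomial \<alpha> x) = norm x ^ l * q x" if "x \<noteq> 0" for x
  proof -
    have "c \<alpha> * monomial \<alpha> x = norm x ^ l * (c \<alpha> * ray_monomial \<alpha> x)" if "\<alpha> \<in> leading_exponents l" for \<alpha>
      using \<open>x \<noteq> 0\<close> degl[OF that] by (simp add: scaled_monomial_def power_inverse)
    then show ?thesis
      unfolding ray[OF that, symmetric] sum_distrib_left by (rule sum.cong[OF refl])
  qed
  have AB: "(\<Sum>k\<le>l. c (exponent k (l - k) 0) * a ^ k) = 0 \<and>
      (\<Sum>k<l. c (exponent k (l - 1 - k) 1) * a ^ k) = 0" for a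
  proof -
    obtain p where p: "\<And>z. norm (vec3 a 1 z) ^ l * q (vec3 a 1 z) = poly ([:a\<^sup>2 + 1, 0, 1:] * p) z"
      using tail_span_divisible[OF q, of a] by blast
    have "(\<Sum>k\<le>l. c (exponent k (l - k) 0) * a ^ k) + (\<Sum>k<l. c (exponent k (l - 1 - k) 1) * a ^ k) * z =
        poly ([:a\<^sup>2 + 1, 0, 1:] * p) z" for z
      using mono[OF vec3_nonzero[of 1 a z]] p[of z]
      by (simp add: sum_leading_exponents monomial_vec3 sum_distrib_right mult.assoc)
    then show ?thesis by (rule linear_poly_divisible_by_quadratic_imp_0)
  qed
  have "c (exponent k (l - k) 0) = 0" if "k \<le> l" for k
    using zero_polynom_imp_zero_coeffs[of "\<lambda>k. c (exponent k (l - k) 0)" l k] AB that by blast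
  moreover have "c (exponent k (l - 1 - k) 1) = 0" if "k < l" for k
  proof -
    have "{..<l} = {..l - 1}" using that by auto
    then show ?thesis
      using zero_polynom_imp_zero_coeffs[of "\<lambda>k. c (exponent k (l - 1 - k) 1)" "l - 1" k] AB that by simp
  qed
  ultimately show ?thesis
    using \<alpha> unfolding leading_exponents_def by blast
qed

lemma spherical_harmonics_inj: "inj_on spherical_harmonic (leading_exponents l)"
proof (rule inj_onI, rule ccontr)
  fix \<alpha> \<beta>
  assume ab: "\<alpha> \<in> leading_exponents l" "\<beta> \<in> leading_exponents l"
    "spherical_harmonic \<alpha> = spherical_harmonic \<beta>" "\<alpha> \<noteq> \<beta>"
  define c :: "(3 \<Rightarrow> nat) \<Rightarrow> real" where "c = (\<lambda>\<gamma>. (if \<gamma> = \<alpha> then 1 else 0) - (if \<gamma> = \<beta> then 1 else 0))"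
  have "(\<Sum>\<gamma>\<in>leading_exponents l. c \<gamma> * spherical_harmonic \<gamma> x) = 0" for x
    using ab finite_leading_exponents
    by (simp add: c_def left_diff_distrib sum_subtractf if_distrib[of "\<lambda>t. t * _"] cong: if_cong)
  then have "c \<alpha> = 0" using ab(1) by (rule spherical_harmonics_scalars_zero)
  then show False using ab(4) by (simp add: c_def)
qed

lemma spherical_harmonics_independent:
  "real_fun.independent (spherical_harmonic ` leading_exponents l)"
proof (rule real_fun.independent_if_scalars_zero)
  fix u h
  assume sum: "(\<Sum>h\<in>spherical_harmonic ` leading_exponents l. (\<lambda>x. u h * h x)) = 0"
    and "h \<in> spherical_harmonic ` leading_exponents l"
  then obtain \<alpha> where \<alpha>: "\<alpha> \<in> leading_exponents l" "h = spherical_harmonic \<alpha>" by blast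
  have "(\<Sum>\<alpha>\<in>leading_exponents l. u (spherical_harmonic \<alpha>) * spherical_harmonic \<alpha> x) = 0" for x
  proof -
    have "(\<Sum>h\<in>spherical_harmonic ` leading_exponents l. (\<lambda>x. u h * h x)) x = 0"
      unfolding sum by simp
    then show ?thesis
      by (simp add: sum_fun_apply sum.reindex[OF spherical_harmonics_inj])
  qed
  from spherical_harmonics_scalars_zero[OF this \<alpha>(1)] show "u h = 0"
    using \<alpha>(2) by simp
qed (simp add: finite_leading_exponents)

section \<open>The spectrum of the sphere\<close>

text \<open>The \<open>2 l + 1\<close> spherical harmonics are independent, and there are exactly as many critical exponents,
which bound the size of any finite independent set in the eigenspace.\<close>

theorem multiplicity_level: "multiplicity_of_eigenvalue (real l * (real l + 1)) = 2 * l + 1"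
proof -
  let ?E = "eigenspace (real l * (real l + 1))" and ?B = "spherical_harmonic ` leading_exponents l"
  have B: "?B \<subseteq> ?E"
  proof clarify
    fix \<alpha> assume "\<alpha> \<in> leading_exponents l"
    then have "deg \<alpha> = l" by (auto simp: leading_exponents_def deg_exponent)
    then show "spherical_harmonic \<alpha> \<in> ?E" using spherical_harmonic_in_eigenspace[of \<alpha>] by simp
  qed
  have card: "card ?B = 2 * l + 1"
    by (simp add: card_image spherical_harmonics_inj card_leading_exponents)
  have fin: "finite ?B" by (simp add: finite_leading_exponents)
  have "f \<in> real_fun.span ?B" if "f \<in> ?E" for f
  proof (rule ccontr)
    assume f: "f \<notin> real_fun.span ?B"
    then have "real_fun.independent (insert f ?B)"
      by (intro real_fun.independent_insertI spherical_harmonics_independent)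
    then have "card (insert f ?B) \<le> card (critical_exponents (real l * (real l + 1)))"
      using B that fin by (intro eigenspace_independent_card_le)
        (auto simp: critical_exponents_level finite_leading_exponents)
    moreover have "f \<notin> ?B" using f real_fun.span_base by blast
    ultimately show False
      using fin card by (simp add: critical_exponents_level card_leading_exponents)
  qed
  then have "real_fun.span ?E \<subseteq> real_fun.span ?B"
    by (intro real_fun.span_minimal real_fun.subspace_span) blast
  then have "real_fun.span ?B = real_fun.span ?E"
    using real_fun.span_mono[OF B] by blast
  from real_fun.dim_eq_card[OF this spherical_harmonics_independent] card
  show ?thesis unfolding multiplicity_of_eigenvalue_def by simp
qed

theorem eigenvalues_sphere: "eigenvalues = range (\<lambda>l::nat. real l * (real l + 1))"
proof
  show "eigenvalues \<subseteq> range (\<lambda>l::nat. real l * (real l + 1))"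
  proof
    fix \<mu> assume "\<mu> \<in> eigenvalues"
    then obtain f x where f: "f \<in> eigenspace \<mu>" "f x \<noteq> 0" by (auto simp: eigenvalues_def)
    show "\<mu> \<in> range (\<lambda>l::nat. real l * (real l + 1))"
    proof (rule ccontr)
      assume "\<mu> \<notin> range (\<lambda>l::nat. real l * (real l + 1))"
      then have "f = (\<lambda>_. 0)"
        using critical_exponents_empty by (intro eigenfunction_determined_by_critical_moments[OF f(1)]) blast
      then show False using f(2) by simp
    qed
  qed
  show "range (\<lambda>l::nat. real l * (real l + 1)) \<subseteq> eigenvalues"
  proof clarify
    fix l :: nat
    let ?\<alpha> = "exponent l 0 0"
    have \<alpha>: "?\<alpha> \<in> leading_exponents l" by (auto simp: leading_exponents_def)
    have "\<exists>x. spherical_harmonic ?\<alpha> x \<noteq> 0"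
    proof (rule ccontr)
      assume "\<not> ?thesis"
      then have "(\<Sum>\<gamma>\<in>leading_exponents l. (if \<gamma> = ?\<alpha> then 1 else 0) * spherical_harmonic \<gamma> x) = 0" for x
        by (intro sum.neutral) auto
      from spherical_harmonics_scalars_zero[OF this \<alpha>] show False by simp
    qed
    then obtain x where x: "spherical_harmonic ?\<alpha> x \<noteq> 0" by blast
    then have "x \<in> S2" by (auto simp: spherical_harmonic_def split: if_splits)
    moreover have "spherical_harmonic ?\<alpha> \<in> eigenspace (real l * (real l + 1))"
      using spherical_harmonic_in_eigenspace[of ?\<alpha>] by (simp add: deg_exponent)
    ultimately show "real l * (real l + 1) \<in> eigenvalues"
      using x unfolding eigenvalues_def by blast
  qed
qed

section \<open>The Riesz mean\<close>

lemma Riesz_mean_eq_finite_sum: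
  assumes below: "real L * (real L + 1) \<le> z" and above: "z < (real L + 1) * (real L + 2)"
  shows "R\<^sub>1 z = (\<Sum>l\<le>L. (2 * real l + 1) * (z - real l * (real l + 1)))"
proof -
  let ?e = "\<lambda>l::nat. real l * (real l + 1)"
  have mono: "?e m \<le> ?e n" if "m \<le> n" for m n
    using that by (intro mult_mono) auto
  have "R\<^sub>1 z = (\<Sum>\<^sub>\<infinity>\<mu>\<in>?e ` {..L}. real (multiplicity_of_eigenvalue \<mu>) * max (z - \<mu>) 0)"
    unfolding R\<^sub>1_def eigenvalues_sphere
  proof (rule infsum_cong_neutral)
    fix \<mu> assume "\<mu> \<in> range ?e - ?e ` {..L}"
    then obtain l where "\<mu> = ?e l" "l \<notin> {..L}" by blast
    then have l: "\<mu> = ?e l" "Suc L \<le> l" by auto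
    have "z < ?e (Suc L)" using above by (simp add: algebra_simps)
    then have "z < \<mu>" using mono[OF l(2)] l(1) by linarith
    then show "real (multiplicity_of_eigenvalue \<mu>) * max (z - \<mu>) 0 = 0" by simp
  qed auto
  also have "\<dots> = (\<Sum>\<mu>\<in>?e ` {..L}. real (multiplicity_of_eigenvalue \<mu>) * max (z - \<mu>) 0)"
    by simp
  also have "\<dots> = (\<Sum>l\<le>L. real (multiplicity_of_eigenvalue (?e l)) * max (z - ?e l) 0)"
    by (rule sum.reindex_cong[OF _ refl refl]) (auto simp: inj_on_def level_inj)
  also have "\<dots> = (\<Sum>l\<le>L. (2 * real l + 1) * (z - ?e l))"
  proof (rule sum.cong[OF refl])
    fix l assume "l \<in> {..L}"
    then have "?e l \<le> z" using mono[of l L] below by simp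
    then show "real (multiplicity_of_eigenvalue (?e l)) * max (z - ?e l) 0 = (2 * real l + 1) * (z - ?e l)"
      by (simp add: multiplicity_level max_def)
  qed
  finally show ?thesis .
qed

lemma sum_multiplicity_times_gap:
  "(\<Sum>l\<le>L. (2 * real l + 1) * (z - real l * (real l + 1))) =
    (real L + 1)\<^sup>2 * z - real L * (real L + 1)\<^sup>2 * (real L + 2) / 2"
  by (induction L) (simp_all add: field_simps power2_eq_square)

text \<open>With \<open>M = L + 1\<close> the finite sum equals \<open>M\<^sup>2 z - M\<^sup>2 (M\<^sup>2 - 1) / 2\<close>, so its difference from \<open>z\<^sup>2 / 2\<close> is
\<open>(M\<^sup>2 - (z - M\<^sup>2)\<^sup>2) / 2\<close>. Writing \<open>z = (L + t) (L + t + 1)\<close> makes this divisible by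
\<open>t (1 - t) = 1/4 - \<psi>(w)\<^sup>2\<close>.\<close>

lemma Riesz_mean_remainder:
  fixes w z :: real
  assumes "0 \<le> w" "w * (w + 1) = z"
  defines "L \<equiv> real_of_int \<lfloor>w\<rfloor>" and "t \<equiv> frac w"
  shows "R\<^sub>1 z = z\<^sup>2 / 2 + 2 * (1/4 - (\<psi> w)\<^sup>2) * (z + ((L + 1) * (1 - 2 * t) + 3/2 * t * (1 - t)) / 2)"
proof -
  define n where "n = nat \<lfloor>w\<rfloor>"
  have n: "real n = L" using assms(1) by (simp add: n_def L_def)
  have w: "w = L + t" by (simp add: L_def t_def frac_def)
  have t: "0 \<le> t" "t < 1" unfolding t_def by (simp_all add: frac_lt_1)
  have L: "0 \<le> L" using n by linarith
  have "L * (L + 1) \<le> w * (w + 1)" "w * (w + 1) < (L + 1) * (L + 2)"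
    using w t L by (auto intro!: mult_mono mult_strict_mono)
  then have R: "R\<^sub>1 z = (L + 1)\<^sup>2 * z - L * (L + 1)\<^sup>2 * (L + 2) / 2"
    using Riesz_mean_eq_finite_sum[of n z] sum_multiplicity_times_gap[of z n] n assms(2) by simp
  have \<psi>: "\<psi> w = t - 1/2"
    by (simp add: \<psi>_def t_def frac_def)
  have z: "z = (L + t) * (L + t + 1)"
    using assms(2) w by simp
  show ?thesis
    unfolding R \<psi> unfolding z by (simp add: power2_eq_square field_simps)
qed

text \<open>The remainder \<open>E\<close> in the exact formula is compared with \<open>\<surd>z\<close> through \<open>L + t = w \<le> \<surd>z\<close>. The bounds on
the oscillating factor serve the limit.\<close>

lemma Riesz_mean_bounds:
  fixes w z :: real
  assumes "0 \<le> w" "w * (w + 1) = z"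
  shows "z\<^sup>2 / 2 + 2 * (1/4 - (\<psi> w)\<^sup>2) * (z - sqrt z / 2) \<le> R\<^sub>1 z"
    and "R\<^sub>1 z \<le> z\<^sup>2 / 2 + 2 * (1/4 - (\<psi> w)\<^sup>2) * (z + sqrt z / 2 + 1/2)"
    and "0 \<le> 2 * (1/4 - (\<psi> w)\<^sup>2)" and "2 * (1/4 - (\<psi> w)\<^sup>2) \<le> 1/2"
proof -
  define L where "L = real_of_int \<lfloor>w\<rfloor>"
  define t where "t = frac w"
  have w: "w = L + t" by (simp add: L_def t_def frac_def)
  have t: "0 \<le> t" "t < 1" unfolding t_def by (simp_all add: frac_lt_1)
  have L: "0 \<le> L" using assms(1) by (simp add: L_def)
  have \<psi>: "2 * (1/4 - (\<psi> w)\<^sup>2) = 2 * (t * (1 - t))"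
    by (simp add: \<psi>_def t_def frac_def power2_eq_square field_simps)
  show nonneg: "0 \<le> 2 * (1/4 - (\<psi> w)\<^sup>2)" unfolding \<psi> using t by simp
  show "2 * (1/4 - (\<psi> w)\<^sup>2) \<le> 1/2" using zero_le_power2[of "\<psi> w"] by simp
  have "w\<^sup>2 \<le> z" using assms by (simp add: power2_eq_square algebra_simps)
  then have s: "L + t \<le> sqrt z" unfolding w[symmetric] by (rule real_le_rsqrt)
  have tt: "0 \<le> t * (1 - t)" "t * (1 - t) \<le> t" using t by (auto intro: mult_left_le)
  have Lt: "0 \<le> L * t" "0 \<le> L * (1 - t)" using L t by simp_all
  define E where "E = (L + 1) * (1 - 2 * t) + 3/2 * t * (1 - t)"
  have expand: "E = L * (1 - t) - L * t + 1 - 2 * t + 3/2 * (t * (1 - t))"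
    and "L * (1 - t) + L * t = L"
    by (simp_all add: E_def algebra_simps)
  note bounds = this(2) s t tt Lt
  have lo: "- sqrt z \<le> E"
    unfolding expand using bounds by linarith
  have hi: "E \<le> sqrt z + 1"
    unfolding expand using bounds by linarith
  note R = Riesz_mean_remainder[OF assms, folded L_def t_def, folded E_def]
  show "z\<^sup>2 / 2 + 2 * (1/4 - (\<psi> w)\<^sup>2) * (z - sqrt z / 2) \<le> R\<^sub>1 z"
    unfolding R by (intro add_left_mono mult_left_mono nonneg) (use lo in linarith)
  show "R\<^sub>1 z \<le> z\<^sup>2 / 2 + 2 * (1/4 - (\<psi> w)\<^sup>2) * (z + sqrt z / 2 + 1/2)"
    unfolding R by (intro add_left_mono mult_left_mono nonneg) (use hi in linarith)
qed

theorem theorem3p1p1: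
  fixes w :: "real \<Rightarrow> real"
  assumes w: "\<And>z. z \<ge> 0 \<Longrightarrow> w z \<ge> 0 \<and> w z * (w z + 1) = z"
  shows "(\<forall>z\<ge>0.
            1/2 * z\<^sup>2 + 2 * (1/4 - (\<psi> (w z))\<^sup>2) * (z - sqrt z / 2) \<le> R\<^sub>1 z \<and>
            R\<^sub>1 z \<le> 1/2 * z\<^sup>2 + 2 * (1/4 - (\<psi> (w z))\<^sup>2) * (z + sqrt z / 2 + 1/2)) \<and>
         (\<forall>\<epsilon>>0. ((\<lambda>z. z powr (- \<epsilon> - 1/2) *
                        (R\<^sub>1 z - 1/2 * z\<^sup>2 - 2 * (1/4 - (\<psi> (w z))\<^sup>2) * z)) \<longlongrightarrow> 0) at_top)"
proof (intro conjI allI impI)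
  fix z :: real assume z: "0 \<le> z"
  note b = Riesz_mean_bounds[of "w z" z]
  show "1/2 * z\<^sup>2 + 2 * (1/4 - (\<psi> (w z))\<^sup>2) * (z - sqrt z / 2) \<le> R\<^sub>1 z"
    "R\<^sub>1 z \<le> 1/2 * z\<^sup>2 + 2 * (1/4 - (\<psi> (w z))\<^sup>2) * (z + sqrt z / 2 + 1/2)"
    using b w[OF z] by simp_all
next
  fix \<epsilon> :: real assume \<epsilon>: "\<epsilon> > 0"
  show "((\<lambda>z. z powr (- \<epsilon> - 1/2) *
      (R\<^sub>1 z - 1/2 * z\<^sup>2 - 2 * (1/4 - (\<psi> (w z))\<^sup>2) * z)) \<longlongrightarrow> 0) at_top"
  proof (rule Lim_null_comparison)
    show "\<forall>\<^sub>F z in at_top. norm (z powr (- \<epsilon> - 1/2) *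
        (R\<^sub>1 z - 1/2 * z\<^sup>2 - 2 * (1/4 - (\<psi> (w z))\<^sup>2) * z)) \<le> z powr (- \<epsilon>)"
    proof (rule eventually_mono[OF eventually_ge_at_top[of "1::real"]])
      fix z :: real assume z: "1 \<le> z"
      define k where "k = 2 * (1/4 - (\<psi> (w z))\<^sup>2)"
      define r where "r = R\<^sub>1 z - 1/2 * z\<^sup>2 - k * z"
      have b: "z\<^sup>2 / 2 + k * (z - sqrt z / 2) \<le> R\<^sub>1 z" "R\<^sub>1 z \<le> z\<^sup>2 / 2 + k * (z + sqrt z / 2 + 1/2)"
        "0 \<le> k" "k \<le> 1/2"
        using Riesz_mean_bounds[of "w z" z] w[of z] z unfolding k_def by simp_all
      have s: "1 \<le> sqrt z" using z by simp
      have "\<bar>r\<bar> \<le> k * (sqrt z / 2 + 1/2)"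
        using b s by (simp add: r_def abs_le_iff algebra_simps)
      also have "\<dots> \<le> 1 * sqrt z"
        by (intro mult_mono) (use b s in linarith)+
      finally have "\<bar>r\<bar> \<le> z powr (1/2)"
        using z by (simp add: powr_half_sqrt)
      then have "z powr (- \<epsilon> - 1/2) * \<bar>r\<bar> \<le> z powr (- \<epsilon> - 1/2) * z powr (1/2)"
        by (intro mult_left_mono) auto
      also have "\<dots> = z powr (- \<epsilon>)"
        by (simp flip: powr_add)
      finally show "norm (z powr (- \<epsilon> - 1/2) * (R\<^sub>1 z - 1/2 * z\<^sup>2 - 2 * (1/4 - (\<psi> (w z))\<^sup>2) * z)) \<le> z powr (- \<epsilon>)"
        by (simp add: r_def k_def abs_mult)
    qed
    show "((\<lambda>z::real. z powr (- \<epsilon>)) \<longlongrightarrow> 0) at_top"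
      using \<epsilon> by (intro tendsto_neg_powr filterlim_ident) auto
  qed
qed

end
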